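(* Let $u$ be a weak solution in $\Omega$. Then there is no stagnation point $x\in\partial\{u<0\}$ with $x_2>x_2^0$; that is, the set $S^u=\{x\in\partial\{u<0\}:|\nabla u^-(x)|=0\}$ contains no point with $x_2>x_2^0$.
   Context: Let $\Omega\subset\mathbb{R}^2$ be open and $x_2^0\in\mathbb{R}$ a constant. $u^+=\max\{u,0\}$, $u^-=\min\{u,0\}$, $\chi_A$ is the characteristic function of $A$. A weak solution is $u\in W^{1,2}(\Omega)$ with: (i) $u\in C(\Omega)\cap C^2(\Omega\cap\{u\ne0\})$; (ii) for every $\phi=(\phi_1,\phi_2)\in C^1_0(\Omega;\mathbb{R}^2)$, $0=\int_\Omega(|\nabla u|^2\mathrm{div}\phi-2\nabla u\,D\phi\,\nabla u)dx+\int_{\Omega\cap\{x_2<x_2^0\}}((x_2^0-x_2)\chi_{\{u<0\}}\mathrm{div}\phi-\chi_{\{u<0\}}\phi_2)dx+\int_{\Omega\cap\{x_2>x_2^0\}}((x_2-x_2^0)\chi_{\{u>0\}}\mathrm{div}\phi+\chi_{\{u>0\}}\phi_2)dx$; (iii) $\partial\{u<0\}\cap\Omega$ is locally a $C^{2,\alpha}$ curve. (This encodes $\Delta u=0$ in $\{u\ne0\}$ and the transition condition $|\nabla u^-|^2-|\nabla u^+|^2=x_2^0-x_2$ on $\partial\{u>0\}\cap\partial\{u<0\}$.) The gradient $\nabla u^-$ at points of $\partial\{u<0\}$ is taken from the side $\{u<0\}$. *)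

theory Defs
  imports "HOL-Analysis.Analysis"
begin

text \<open>C^1 functions with compact support in the open set Omega (extended by zero to the
  whole plane): the class C^1_0(Omega).\<close>
definition C1c_on :: "(real \<times> real) set \<Rightarrow> (real \<times> real \<Rightarrow> 'b::real_normed_vector) \<Rightarrow> bool" where
  "C1c_on \<Omega> \<phi> \<longleftrightarrow>
     (\<exists>D. (\<forall>x. (\<phi> has_derivative blinfun_apply (D x)) (at x)) \<and> continuous_on UNIV D) \<and>
     compact (closure {x. \<phi> x \<noteq> 0}) \<and> closure {x. \<phi> x \<noteq> 0} \<subseteq> \<Omega>"

definition div2 :: "(real \<times> real \<Rightarrow> real \<times> real) \<Rightarrow> real \<times> real \<Rightarrow> real" where
  "div2 \<phi> x = (\<Sum>e\<in>Basis. frechet_derivative \<phi> (at x) e \<bullet> e)"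

definition weak_gradient :: "(real \<times> real) set \<Rightarrow> (real \<times> real \<Rightarrow> real) \<Rightarrow> (real \<times> real \<Rightarrow> real \<times> real) \<Rightarrow> bool" where
  "weak_gradient \<Omega> u g \<longleftrightarrow>
     (\<forall>\<psi>::real \<times> real \<Rightarrow> real. C1c_on \<Omega> \<psi> \<longrightarrow>
        (\<forall>e\<in>(Basis :: (real \<times> real) set).
           integral \<Omega> (\<lambda>x. u x * frechet_derivative \<psi> (at x) e) = - integral \<Omega> (\<lambda>x. \<psi> x * (g x \<bullet> e))))"

definition W12_with_grad :: "(real \<times> real) set \<Rightarrow> (real \<times> real \<Rightarrow> real) \<Rightarrow> (real \<times> real \<Rightarrow> real \<times> real) \<Rightarrow> bool" where
  "W12_with_grad \<Omega> u g \<longleftrightarrow>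
     u measurable_on \<Omega> \<and> (\<lambda>x. (u x)\<^sup>2) integrable_on \<Omega> \<and>
     g measurable_on \<Omega> \<and> (\<lambda>x. (norm (g x))\<^sup>2) integrable_on \<Omega> \<and>
     weak_gradient \<Omega> u g"

definition C2_on :: "(real \<times> real) set \<Rightarrow> (real \<times> real \<Rightarrow> real) \<Rightarrow> bool" where
  "C2_on U u \<longleftrightarrow>
     (\<exists>(Du :: real \<times> real \<Rightarrow> (real \<times> real) \<Rightarrow>\<^sub>L real)
        (D2u :: real \<times> real \<Rightarrow> (real \<times> real) \<Rightarrow>\<^sub>L ((real \<times> real) \<Rightarrow>\<^sub>L real)).
        (\<forall>x\<in>U. (u has_derivative blinfun_apply (Du x)) (at x)) \<and>
        (\<forall>x\<in>U. (Du has_derivative blinfun_apply (D2u x)) (at x)) \<and>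
        continuous_on U D2u)"

definition C2alpha :: "real \<Rightarrow> (real \<Rightarrow> real) \<Rightarrow> bool" where
  "C2alpha \<alpha> f \<longleftrightarrow>
     (\<exists>f' f''. (\<forall>s. (f has_real_derivative f' s) (at s)) \<and>
               (\<forall>s. (f' has_real_derivative f'' s) (at s)) \<and>
               (\<exists>C. \<forall>s t. \<bar>f'' s - f'' t\<bar> \<le> C * \<bar>s - t\<bar> powr \<alpha>))"

definition rot1 :: "real \<Rightarrow> real \<times> real \<Rightarrow> real" where
  "rot1 \<theta> x = cos \<theta> * fst x + sin \<theta> * snd x"
definition rot2 :: "real \<Rightarrow> real \<times> real \<Rightarrow> real" where
  "rot2 \<theta> x = - sin \<theta> * fst x + cos \<theta> * snd x"

definition locally_C2alpha_curve :: "real \<Rightarrow> (real \<times> real) set \<Rightarrow> (real \<times> real) set \<Rightarrow> bool" where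
  "locally_C2alpha_curve \<alpha> \<Gamma> U \<longleftrightarrow>
     (\<forall>x0\<in>\<Gamma> \<inter> U. \<exists>r>0. ball x0 r \<subseteq> U \<and>
        (\<exists>\<theta> f. C2alpha \<alpha> f \<and>
           \<Gamma> \<inter> ball x0 r = {x \<in> ball x0 r. rot2 \<theta> x = f (rot1 \<theta> x)}))"

definition weak_solution :: "(real \<times> real) set \<Rightarrow> real \<Rightarrow> (real \<times> real \<Rightarrow> real) \<Rightarrow> bool" where
  "weak_solution \<Omega> x20 u \<longleftrightarrow>
     (\<exists>g. W12_with_grad \<Omega> u g \<and>
        continuous_on \<Omega> u \<and> C2_on {x\<in>\<Omega>. u x \<noteq> 0} u \<and>
        (\<forall>\<phi>::real \<times> real \<Rightarrow> real \<times> real. C1c_on \<Omega> \<phi> \<longrightarrow>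
           integral \<Omega> (\<lambda>x. (norm (g x))\<^sup>2 * div2 \<phi> x
                             - 2 * (g x \<bullet> frechet_derivative \<phi> (at x) (g x)))
         + integral {x\<in>\<Omega>. snd x < x20}
             (\<lambda>x. (x20 - snd x) * indicator {y. u y < 0} x * div2 \<phi> x
                  - indicator {y. u y < 0} x * snd (\<phi> x))
         + integral {x\<in>\<Omega>. snd x > x20}
             (\<lambda>x. (snd x - x20) * indicator {y. u y > 0} x * div2 \<phi> x
                  + indicator {y. u y > 0} x * snd (\<phi> x))
         = 0) \<and>
        (\<exists>\<alpha>. 0 < \<alpha> \<and> \<alpha> < 1 \<and> locally_C2alpha_curve \<alpha> (frontier {x\<in>\<Omega>. u x < 0}) \<Omega>))"

definition uminus_part :: "(real \<times> real \<Rightarrow> real) \<Rightarrow> real \<times> real \<Rightarrow> real" where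
  "uminus_part u x = min (u x) 0"

definition stagnation_set :: "(real \<times> real) set \<Rightarrow> (real \<times> real \<Rightarrow> real) \<Rightarrow> (real \<times> real) set" where
  "stagnation_set \<Omega> u =
     {x \<in> frontier {y\<in>\<Omega>. u y < 0} \<inter> \<Omega>.
        (uminus_part u has_derivative (\<lambda>h. 0)) (at x within {y\<in>\<Omega>. u y < 0})}"

end

theory Submission
  imports Defs
begin

text \<open>
  Where u < 0 and x2 > x20, both bulk terms of the domain variation formula vanish, and testing with a
  scalar bump times a constant vector v gives (Laplacian u) * (grad u . v) = 0. Hence u is harmonic
  there: if its Laplacian were nonzero at a point, the gradient, and so the Laplacian itself, would
  vanish nearby. The C^2 curve that bounds {u < 0} admits an interior touching ball at each of its
  points, and Hopf's boundary point lemma then forces a nonzero one-sided derivative of u.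
\<close>

subsection \<open>Functions of class C^1 on plane domains\<close>

text \<open>The variation formula is an identity for the distributional gradient \<open>g\<close>,
  known only up to null sets, while everything after it is pointwise. The link is that
  \<open>g\<close> agrees almost everywhere with the classical gradient on closed boxes where
  \<open>u\<close> is C^2. Test functions are products of one-variable bumps living on a box, so
  integrating against their derivatives reduces to Fubini and the fundamental theorem of calculus,
  with zero boundary terms. Derivatives are carried as pairs of scalar partials, which turns the
  pointwise identities into ring algebra. The product identity rests on the fact that the field
  |grad u|^2 v - 2 (grad u . v) grad u has divergence -2 (Laplacian u) (grad u . v). The curve
  condition describes only the frontier of {u < 0}, not the side on which u is negative. The
  touching ball is therefore placed on a side from which {u < 0} accumulates at the point, and
  connectedness shows that it lies in {u < 0}. Hopf's lemma compares u in an annulus with a multiple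
  of the inverse squared distance to the centre of that ball.\<close>

definition C1_partials ::
  "(real \<times> real) set \<Rightarrow> (real \<times> real \<Rightarrow> real) \<Rightarrow> (real \<times> real \<Rightarrow> real) \<Rightarrow> (real \<times> real \<Rightarrow> real) \<Rightarrow> bool"
  where
  "C1_partials U w p q \<longleftrightarrow>
     (\<forall>x\<in>U. (w has_derivative (\<lambda>h. p x * fst h + q x * snd h)) (at x)) \<and>
     continuous_on U p \<and> continuous_on U q"

lemma C1_partialsD:
  assumes "C1_partials U w p q"
  shows "\<And>x. x \<in> U \<Longrightarrow> (w has_derivative (\<lambda>h. p x * fst h + q x * snd h)) (at x)"
    and "continuous_on U p" and "continuous_on U q" and "continuous_on U w"
  using assms unfolding C1_partials_def
  by (auto intro!: continuous_at_imp_continuous_on has_derivative_continuous)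

lemma C1_partials_subset: "C1_partials U w p q \<Longrightarrow> V \<subseteq> U \<Longrightarrow> C1_partials V w p q"
  unfolding C1_partials_def by (blast intro: continuous_on_subset)

lemma C1_partials_mult:
  assumes "C1_partials U v p q" and "C1_partials U w r s"
  shows "C1_partials U (\<lambda>x. v x * w x) (\<lambda>x. p x * w x + v x * r x) (\<lambda>x. q x * w x + v x * s x)"
proof -
  have "((\<lambda>x. v x * w x) has_derivative
      (\<lambda>h. (p x * w x + v x * r x) * fst h + (q x * w x + v x * s x) * snd h)) (at x)" if "x \<in> U" for x
    by (rule has_derivative_eq_rhs[OF has_derivative_mult[OF
            C1_partialsD(1)[OF assms(1) that] C1_partialsD(1)[OF assms(2) that]]])
       (auto simp: algebra_simps)
  then show ?thesis
    unfolding C1_partials_def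
    using C1_partialsD[OF assms(1)] C1_partialsD[OF assms(2)] by (auto intro!: continuous_intros)
qed

lemma C1_partials_add:
  assumes "C1_partials U v p q" and "C1_partials U w r s"
  shows "C1_partials U (\<lambda>x. v x + w x) (\<lambda>x. p x + r x) (\<lambda>x. q x + s x)"
proof -
  have "((\<lambda>x. v x + w x) has_derivative
      (\<lambda>h. (p x + r x) * fst h + (q x + s x) * snd h)) (at x)" if "x \<in> U" for x
    by (rule has_derivative_eq_rhs[OF has_derivative_add[OF
            C1_partialsD(1)[OF assms(1) that] C1_partialsD(1)[OF assms(2) that]]])
       (auto simp: algebra_simps)
  then show ?thesis
    unfolding C1_partials_def
    using C1_partialsD[OF assms(1)] C1_partialsD[OF assms(2)] by (auto intro!: continuous_intros)
qed

lemma C1_partials_cmult: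
  assumes "C1_partials U v p q"
  shows "C1_partials U (\<lambda>x. c * v x) (\<lambda>x. c * p x) (\<lambda>x. c * q x)"
proof -
  have "((\<lambda>x. c * v x) has_derivative (\<lambda>h. c * p x * fst h + c * q x * snd h)) (at x)"
    if "x \<in> U" for x
    by (rule has_derivative_eq_rhs[OF has_derivative_mult_right[OF C1_partialsD(1)[OF assms that]]])
       (auto simp: algebra_simps)
  then show ?thesis
    unfolding C1_partials_def
    using C1_partialsD[OF assms(1)] by (auto intro!: continuous_intros)
qed

lemma C1_partials_fst_derivative:
  assumes "C1_partials U w p q" and "(s, y) \<in> U"
  shows "((\<lambda>s. w (s, y)) has_real_derivative p (s, y)) (at s)"
proof -
  have "((\<lambda>s. (s, y)) has_derivative (\<lambda>h. (h, 0))) (at s)"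
    by (auto intro!: derivative_eq_intros)
  from has_derivative_compose[OF this C1_partialsD(1)[OF assms]]
  show ?thesis by (simp add: has_field_derivative_def)
qed

lemma C1_partials_snd_derivative:
  assumes "C1_partials U w p q" and "(s, y) \<in> U"
  shows "((\<lambda>y. w (s, y)) has_real_derivative q (s, y)) (at y)"
proof -
  have "((\<lambda>y. (s, y)) has_derivative (\<lambda>h. (0, h))) (at y)"
    by (auto intro!: derivative_eq_intros)
  from has_derivative_compose[OF this C1_partialsD(1)[OF assms]]
  show ?thesis by (simp add: has_field_derivative_def)
qed

section \<open>Integrals of partial derivatives over boxes\<close>

lemma integral_cbox_partial_snd:
  assumes w: "C1_partials U w p q" and sub: "cbox (a, c) (b, d) \<subseteq> U" and cd: "c \<le> d"
  shows "integral (cbox (a, c) (b, d)) q = integral {a..b} (\<lambda>s. w (s, d) - w (s, c))"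
proof -
  have "integral (cbox (a, c) (b, d)) q =
      integral (cbox a b) (\<lambda>s. integral (cbox c d) (\<lambda>y. q (s, y)))"
    using C1_partialsD(3)[OF w] sub by (intro integral_prod_continuous) (rule continuous_on_subset)
  also have "\<dots> = integral (cbox a b) (\<lambda>s. w (s, d) - w (s, c))"
  proof (rule integral_cong)
    fix s assume s: "s \<in> cbox a b"
    have "((\<lambda>y. q (s, y)) has_integral w (s, d) - w (s, c)) {c..d}"
    proof (rule fundamental_theorem_of_calculus[OF cd])
      fix y assume "y \<in> {c..d}"
      then have "(s, y) \<in> U" using s sub by (auto simp: cbox_Pair_eq)
      then show "((\<lambda>y. w (s, y)) has_vector_derivative q (s, y)) (at y within {c..d})"
        using C1_partials_snd_derivative[OF w]
        by (simp add: has_real_derivative_iff_has_vector_derivative has_vector_derivative_at_within)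
    qed
    then show "integral (cbox c d) (\<lambda>y. q (s, y)) = w (s, d) - w (s, c)"
      by (simp add: integral_unique)
  qed
  finally show ?thesis by simp
qed

lemma integral_cbox_partial_fst:
  assumes w: "C1_partials U w p q" and sub: "cbox (a, c) (b, d) \<subseteq> U" and ab: "a \<le> b"
  shows "integral (cbox (a, c) (b, d)) p = integral {c..d} (\<lambda>y. w (b, y) - w (a, y))"
proof -
  have cont: "continuous_on (cbox (a, c) (b, d)) p"
    using C1_partialsD(2)[OF w] sub by (rule continuous_on_subset)
  have "integral (cbox (a, c) (b, d)) p =
      integral (cbox a b) (\<lambda>s. integral (cbox c d) (\<lambda>y. p (s, y)))"
    using cont by (rule integral_prod_continuous)
  \<comment> \<open>Fubini leaves the second coordinate innermost; the order is swapped so that the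
    fundamental theorem applies in the first one.\<close>
  also have "\<dots> = integral (cbox c d) (\<lambda>y. integral (cbox a b) (\<lambda>s. p (s, y)))"
    using cont by (intro integral_swap_continuous) (simp add: case_prod_eta)
  also have "\<dots> = integral (cbox c d) (\<lambda>y. w (b, y) - w (a, y))"
  proof (rule integral_cong)
    fix y assume y: "y \<in> cbox c d"
    have "((\<lambda>s. p (s, y)) has_integral w (b, y) - w (a, y)) {a..b}"
    proof (rule fundamental_theorem_of_calculus[OF ab])
      fix s assume "s \<in> {a..b}"
      then have "(s, y) \<in> U" using y sub by (auto simp: cbox_Pair_eq)
      then show "((\<lambda>s. w (s, y)) has_vector_derivative p (s, y)) (at s within {a..b})"
        using C1_partials_fst_derivative[OF w]
        by (simp add: has_real_derivative_iff_has_vector_derivative has_vector_derivative_at_within)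
    qed
    then show "integral (cbox a b) (\<lambda>s. p (s, y)) = w (b, y) - w (a, y)"
      by (simp add: integral_unique)
  qed
  finally show ?thesis by simp
qed

text \<open>Divergence theorem without boundary terms: the edges of the closed box lie outside the
  open box, so both endpoint values from the fundamental theorem are 0.\<close>

lemma integral_partials_eq_0:
  assumes w: "C1_partials U w p q" and sub: "cbox (a, c) (b, d) \<subseteq> U" and "a \<le> b" "c \<le> d"
    and "\<And>s y. (s, y) \<notin> box (a, c) (b, d) \<Longrightarrow> w (s, y) = 0"
  shows "integral (cbox (a, c) (b, d)) p = 0" "integral (cbox (a, c) (b, d)) q = 0"
  using integral_cbox_partial_fst[OF w sub] integral_cbox_partial_snd[OF w sub] assms(3-)
  by (auto simp: box_prod)

lemma open_contains_small_cbox: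
  fixes z :: "real \<times> real"
  assumes "open U" "z \<in> U"
  obtains e where "0 < e" "cbox (fst z - e, snd z - e) (fst z + e, snd z + e) \<subseteq> U"
    "z \<in> box (fst z - e, snd z - e) (fst z + e, snd z + e)"
proof -
  obtain r where r: "r > 0" "ball z r \<subseteq> U" using assms open_contains_ball by blast
  \<comment> \<open>The distance is at most the sum of the two coordinate differences, hence at most
    2 * r / 3 < r.\<close>
  define e where "e = r / 3"
  have "cbox (fst z - e, snd z - e) (fst z + e, snd z + e) \<subseteq> ball z r"
  proof
    fix x assume "x \<in> cbox (fst z - e, snd z - e) (fst z + e, snd z + e)"
    then have "\<bar>fst x - fst z\<bar> \<le> e" "\<bar>snd x - snd z\<bar> \<le> e"
      by (cases x; auto simp: cbox_Pair_eq)+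
    moreover have "dist x z \<le> \<bar>fst x - fst z\<bar> + \<bar>snd x - snd z\<bar>"
      unfolding dist_norm using norm_fst_le
      by (metis abs_of_nonneg add_increasing dist_norm dist_prod_def dist_real_def norm_Pair norm_ge_zero norm_prod_def real_norm_def sqrt_sum_squares_le_sum_abs)
    ultimately show "x \<in> ball z r" using \<open>r > 0\<close> by (simp add: e_def dist_commute)
  qed
  moreover have "e > 0" using r by (simp add: e_def)
  moreover then have "z \<in> box (fst z - e, snd z - e) (fst z + e, snd z + e)"
    by (cases z) (auto simp: box_prod)
  ultimately show ?thesis using that r by blast
qed

text \<open>A fundamental lemma of the calculus of variations: near a point where \<open>h\<close>
  is nonzero it keeps its sign, and a continuous integrand of one sign with zero integral vanishes.
  The weight may vary with the box, so that both the constant 1 and bumps can serve.\<close>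

lemma weighted_box_integrals_zero_imp_zero:
  fixes h :: "real \<times> real \<Rightarrow> real" and \<eta> :: "real \<times> real \<Rightarrow> real \<times> real \<Rightarrow> real \<times> real \<Rightarrow> real"
  assumes "open U" and h: "continuous_on U h"
    and \<eta>: "\<And>l m. continuous_on UNIV (\<eta> l m)"
      "\<And>l m x. x \<in> box l m \<Longrightarrow> \<eta> l m x > 0"
    and 0: "\<And>a b c d. a < b \<Longrightarrow> c < d \<Longrightarrow> cbox (a, c) (b, d) \<subseteq> U \<Longrightarrow>
           integral (cbox (a, c) (b, d)) (\<lambda>x. \<eta> (a, c) (b, d) x * h x) = 0"
    and "z \<in> U"
  shows "h z = 0"
proof (rule ccontr)
  assume nz: "h z \<noteq> 0"
  \<comment> \<open>The factor \<open>h z\<close> treats both signs of \<open>h z\<close> at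
    once.\<close>
  define V where "V = {x \<in> U. h z * h x > 0}"
  have "open V"
    unfolding V_def using \<open>open U\<close> h
    by (intro continuous_open_preimage[of U "\<lambda>x. h z * h x" "{0<..}", simplified vimage_def Int_def, simplified]
        continuous_intros)
  moreover have "z \<in> V" using nz \<open>z \<in> U\<close> by (auto simp: V_def zero_less_mult_iff)
  ultimately obtain e where e: "e > 0" "cbox (fst z - e, snd z - e) (fst z + e, snd z + e) \<subseteq> V"
    "z \<in> box (fst z - e, snd z - e) (fst z + e, snd z + e)"
    using open_contains_small_cbox by metis
  let ?l = "(fst z - e, snd z - e)" and ?m = "(fst z + e, snd z + e)"
  let ?f = "\<lambda>x. \<eta> ?l ?m x * (h z * h x)"
  have subU: "cbox ?l ?m \<subseteq> U" using e by (auto simp: V_def)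
  have cont: "continuous_on (cbox ?l ?m) ?f"
    using h subU by (intro continuous_intros continuous_on_subset[OF \<eta>(1)]) (auto intro: continuous_on_subset)
  have "integral (cbox ?l ?m) ?f = h z * integral (cbox ?l ?m) (\<lambda>x. \<eta> ?l ?m x * h x)"
    by (simp flip: integral_mult_right add: mult.left_commute)
  also have "\<dots> = 0" using 0[OF _ _ subU] \<open>e > 0\<close> by simp
  finally have "(?f has_integral 0) (cbox ?l ?m)"
    using integrable_integral[OF integrable_continuous[OF cont]] by simp
  then have "?f z = 0"
  proof (rule has_integral_0_cbox_imp_0[OF cont, rotated])
    fix x assume x: "x \<in> box ?l ?m"
    then have "x \<in> V" using e(2) box_subset_cbox[of ?l ?m] by blast
    then have "h z * h x > 0" by (simp add: V_def)
    then show "0 \<le> ?f x"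
      using \<eta>(2)[OF x] by simp
  next
    show "box ?l ?m \<noteq> {}" using e(3) by blast
    show "z \<in> cbox ?l ?m" using e(3) box_subset_cbox by blast
  qed
  then show False using \<eta>(2)[OF e(3)] nz by auto
qed

text \<open>Over any box both mixed partials integrate to the same alternating sum of the four
  corner values of \<open>u\<close>. The symmetry is what cancels the mixed terms in the divergence
  computed for the variation formula.\<close>

lemma mixed_partials_eq:
  assumes "open U" and u: "C1_partials U u u1 u2"
    and u1: "C1_partials U u1 u11 u12" and u2: "C1_partials U u2 u21 u22" and "z \<in> U"
  shows "u12 z = u21 z"
proof -
  have "u12 z - u21 z = 0"
  proof (rule weighted_box_integrals_zero_imp_zero[OF \<open>open U\<close> _ _ _ _ \<open>z \<in> U\<close>, where \<eta>="\<lambda>_ _ _. 1"])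
    fix a b c d :: real
    assume le: "a < b" "c < d" and sub: "cbox (a, c) (b, d) \<subseteq> U"
    have in1: "u12 integrable_on cbox (a, c) (b, d)" "u21 integrable_on cbox (a, c) (b, d)"
      using C1_partialsD(3)[OF u1] C1_partialsD(2)[OF u2] sub
      by (auto intro!: integrable_continuous intro: continuous_on_subset)
    have mem: "(s, y) \<in> U" if "s \<in> {a..b}" "y \<in> {c..d}" for s y
      using that sub by (auto simp: cbox_Pair_eq)
    have "((\<lambda>s. u1 (s, y)) has_integral u (b, y) - u (a, y)) {a..b}" if "y \<in> {c..d}" for y
      using C1_partials_fst_derivative[OF u mem] that le
      by (intro fundamental_theorem_of_calculus)
         (auto simp: has_real_derivative_iff_has_vector_derivative has_vector_derivative_at_within)
    then have "((\<lambda>s. u1 (s, d) - u1 (s, c)) has_integral (u (b, d) - u (a, d)) - (u (b, c) - u (a, c))) {a..b}"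
      using le by (intro has_integral_diff) auto
    moreover have "((\<lambda>y. u2 (s, y)) has_integral u (s, d) - u (s, c)) {c..d}" if "s \<in> {a..b}" for s
      using C1_partials_snd_derivative[OF u mem] that le
      by (intro fundamental_theorem_of_calculus)
         (auto simp: has_real_derivative_iff_has_vector_derivative has_vector_derivative_at_within)
    then have "((\<lambda>y. u2 (b, y) - u2 (a, y)) has_integral (u (b, d) - u (b, c)) - (u (a, d) - u (a, c))) {c..d}"
      using le by (intro has_integral_diff) auto
    ultimately have "integral (cbox (a, c) (b, d)) u12 = integral (cbox (a, c) (b, d)) u21"
      using integral_cbox_partial_snd[OF u1 sub] integral_cbox_partial_fst[OF u2 sub] le
      by (auto dest!: integral_unique)
    then show "integral (cbox (a, c) (b, d)) (\<lambda>x. 1 * (u12 x - u21 x)) = 0"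
      using in1 by (simp add: integral_diff)
  qed (use C1_partialsD[OF u1] C1_partialsD[OF u2] in \<open>auto intro!: continuous_intros\<close>)
  then show ?thesis by simp
qed

subsection \<open>Bump functions and the weak gradient\<close>

text \<open>Squaring the positive part makes the bump C^1; the outer map s \<mapsto> 1 - 1 / (1 + n s) pushes it up
  to the indicator function of the interval as n grows.\<close>

definition bump :: "nat \<Rightarrow> real \<Rightarrow> real \<Rightarrow> real \<Rightarrow> real" where
  "bump n a b t = 1 - 1 / (1 + real n * (max 0 ((t - a) * (b - t)))\<^sup>2)"

definition bump_deriv :: "nat \<Rightarrow> real \<Rightarrow> real \<Rightarrow> real \<Rightarrow> real" where
  "bump_deriv n a b t =
     real n * (2 * max 0 ((t - a) * (b - t))) * (a + b - 2 * t) / (1 + real n * (max 0 ((t - a) * (b - t)))\<^sup>2)\<^sup>2"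

lemma has_real_derivative_pos_part_squared:
  "((\<lambda>y::real. (max 0 y)\<^sup>2) has_real_derivative 2 * max 0 y) (at y)"
proof -
  consider "y > 0" | "y < 0" | "y = 0" by linarith
  then show ?thesis
  proof cases
    case 1
    have "((\<lambda>y::real. y\<^sup>2) has_real_derivative 2 * max 0 y) (at y)"
      using 1 by (auto intro!: derivative_eq_intros)
    then show ?thesis
      by (rule has_field_derivative_transform_within_open[of _ _ _ "{0<..}"]) (use 1 in auto)
  next
    case 2
    have "((\<lambda>y::real. 0) has_real_derivative 2 * max 0 y) (at y)"
      using 2 by (auto intro!: derivative_eq_intros)
    then show ?thesis
      by (rule has_field_derivative_transform_within_open[of _ _ _ "{..<0}"]) (use 2 in auto)
  next
    case 3
    have "((\<lambda>h::real. (max 0 h)\<^sup>2 / h) \<longlongrightarrow> 0) (at 0)"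
    proof (rule Lim_null_comparison)
      show "((\<lambda>h::real. \<bar>h\<bar>) \<longlongrightarrow> 0) (at 0)"
        using tendsto_rabs_zero[OF tendsto_ident_at] .
      show "\<forall>\<^sub>F h::real in at 0. norm ((max 0 h)\<^sup>2 / h) \<le> \<bar>h\<bar>"
        by (intro always_eventually allI) (auto simp: max_def power2_eq_square)
    qed
    then show ?thesis using 3 by (simp add: DERIV_def)
  qed
qed

lemma bump_denominator_pos: "1 + real n * (max 0 s)\<^sup>2 > 0"
  by (simp add: add_pos_nonneg)

lemma bump_has_derivative: "(bump n a b has_real_derivative bump_deriv n a b t) (at t)"
proof -
  have "((\<lambda>t. (t - a) * (b - t)) has_real_derivative a + b - 2 * t) (at t)"
    by (auto intro!: derivative_eq_intros)
  from DERIV_chain2[OF has_real_derivative_pos_part_squared this]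
  have *: "((\<lambda>t. (max 0 ((t - a) * (b - t)))\<^sup>2) has_real_derivative
      2 * max 0 ((t - a) * (b - t)) * (a + b - 2 * t)) (at t)" .
  show ?thesis
    unfolding bump_def bump_deriv_def
    using bump_denominator_pos[of n "(t - a) * (b - t)"]
    by (rule_tac DERIV_cong[OF DERIV_diff[OF DERIV_const DERIV_divide[OF DERIV_const
            DERIV_add[OF DERIV_const DERIV_cmult[OF *]]]]]) (auto simp: power2_eq_square)
qed

lemma continuous_on_bump_deriv: "continuous_on S (bump_deriv n a b)"
  unfolding bump_deriv_def
  using bump_denominator_pos[of n] by (intro continuous_intros ballI) (auto simp: less_imp_neq[THEN not_sym])

lemma bump_bounds: "0 \<le> bump n a b t" "bump n a b t \<le> 1"
  using bump_denominator_pos[of n "(t - a) * (b - t)"] by (auto simp: bump_def)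

lemma bump_pos:
  assumes "a < t" "t < b" "n > 0"
  shows "bump n a b t > 0"
proof -
  have "(t - a) * (b - t) > 0" using assms by simp
  then have "real n * (max 0 ((t - a) * (b - t)))\<^sup>2 > 0"
    using assms(3) by (intro mult_pos_pos zero_less_power) auto
  then show ?thesis by (simp add: bump_def)
qed

lemma bump_outside:
  assumes "a \<le> b" "\<not> (a < t \<and> t < b)"
  shows "bump n a b t = 0" "bump_deriv n a b t = 0"
proof -
  have "(t - a) * (b - t) \<le> 0"
    using assms by (auto simp: mult_le_0_iff)
  then show "bump n a b t = 0" "bump_deriv n a b t = 0"
    by (simp_all add: bump_def bump_deriv_def max_def)
qed

lemma bump_tendsto_1:
  assumes "a < t" "t < b"
  shows "(\<lambda>n. bump n a b t) \<longlonglongrightarrow> 1"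
proof -
  have c: "(max 0 ((t - a) * (b - t)))\<^sup>2 > 0" (is "?c > 0") using assms by simp
  have "filterlim (\<lambda>n. 1 + ?c * real n) at_top sequentially"
    by (intro filterlim_tendsto_add_at_top[OF tendsto_const]
        filterlim_tendsto_pos_mult_at_top[OF tendsto_const c] filterlim_real_sequentially)
  then have "(\<lambda>n. 1 / (1 + ?c * real n)) \<longlonglongrightarrow> 0"
    by (intro tendsto_divide_0[OF tendsto_const] filterlim_at_top_imp_at_infinity)
  from tendsto_diff[OF tendsto_const[of 1] this] show ?thesis
    by (simp add: bump_def mult.commute)
qed

section \<open>Product bumps as test functions\<close>

definition box_bump :: "nat \<Rightarrow> real \<times> real \<Rightarrow> real \<times> real \<Rightarrow> real \<times> real \<Rightarrow> real" where
  "box_bump n l m x = bump n (fst l) (fst m) (fst x) * bump n (snd l) (snd m) (snd x)"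

definition box_bump_fst :: "nat \<Rightarrow> real \<times> real \<Rightarrow> real \<times> real \<Rightarrow> real \<times> real \<Rightarrow> real" where
  "box_bump_fst n l m x = bump_deriv n (fst l) (fst m) (fst x) * bump n (snd l) (snd m) (snd x)"

definition box_bump_snd :: "nat \<Rightarrow> real \<times> real \<Rightarrow> real \<times> real \<Rightarrow> real \<times> real \<Rightarrow> real" where
  "box_bump_snd n l m x = bump n (fst l) (fst m) (fst x) * bump_deriv n (snd l) (snd m) (snd x)"

lemma continuous_on_bump: "continuous_on S (bump n a b)"
  using bump_has_derivative by (intro continuous_at_imp_continuous_on ballI DERIV_isCont)

lemma C1_partials_box_bump:
  "C1_partials U (box_bump n l m) (box_bump_fst n l m) (box_bump_snd n l m)"
proof -
  have *: "((\<lambda>x. bump n a b (f x)) has_derivative (\<lambda>h. bump_deriv n a b (f x) * f h)) (at x)"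
    if "bounded_linear f" for a b f and x :: "real \<times> real"
    using has_derivative_compose[OF bounded_linear_imp_has_derivative[OF that] 
        bump_has_derivative[unfolded has_field_derivative_def]] by simp
  have "(box_bump n l m has_derivative (\<lambda>h. box_bump_fst n l m x * fst h + box_bump_snd n l m x * snd h)) (at x)" for x
    unfolding box_bump_def box_bump_fst_def box_bump_snd_def
    by (rule has_derivative_eq_rhs[OF has_derivative_mult[OF *[OF bounded_linear_fst] *[OF bounded_linear_snd]]])
       (auto simp: algebra_simps)
  moreover have "continuous_on U (box_bump_fst n l m)" "continuous_on U (box_bump_snd n l m)"
    unfolding box_bump_fst_def box_bump_snd_def
    by (intro continuous_intros continuous_on_compose2[OF continuous_on_bump[of UNIV]]
        continuous_on_compose2[OF continuous_on_bump_deriv[of UNIV]]; simp)+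
  ultimately show ?thesis by (simp add: C1_partials_def)
qed

lemma box_bump_outside:
  assumes "a \<le> b" "c \<le> d" "x \<notin> box (a, c) (b, d)"
  shows "box_bump n (a, c) (b, d) x = 0" "box_bump_fst n (a, c) (b, d) x = 0"
    "box_bump_snd n (a, c) (b, d) x = 0"
  using assms bump_outside
  by (cases x; auto simp: box_prod box_bump_def box_bump_fst_def box_bump_snd_def)+

lemma box_bump_pos:
  assumes "x \<in> box l m" "n > 0"
  shows "box_bump n l m x > 0"
  using assms bump_pos by (cases l; cases m; cases x) (auto simp: box_prod box_bump_def)

lemma box_bump_bounds: "0 \<le> box_bump n l m x" "box_bump n l m x \<le> 1"
  using bump_bounds by (auto simp: box_bump_def intro: mult_le_one)

lemma box_bump_tendsto_1:
  assumes "x \<in> box l m"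
  shows "(\<lambda>n. box_bump n l m x) \<longlonglongrightarrow> 1"
proof -
  have "(\<lambda>n. box_bump n l m x) \<longlonglongrightarrow> 1 * 1"
    unfolding box_bump_def using assms
    by (intro tendsto_mult bump_tendsto_1) (cases l; cases m; cases x; auto simp: box_prod)+
  then show ?thesis by simp
qed

lemma C1c_on_box_bump:
  assumes "a \<le> b" "c \<le> d" "cbox (a, c) (b, d) \<subseteq> \<Omega>"
  shows "C1c_on \<Omega> (box_bump n (a, c) (b, d))"
proof -
  let ?\<eta> = "box_bump n (a, c) (b, d)"
  let ?D = "\<lambda>x. box_bump_fst n (a, c) (b, d) x *\<^sub>R fst_blinfun + box_bump_snd n (a, c) (b, d) x *\<^sub>R snd_blinfun
      :: (real \<times> real) \<Rightarrow>\<^sub>L real"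
  note P = C1_partialsD[OF C1_partials_box_bump[of UNIV n "(a, c)" "(b, d)"]]
  have "(?\<eta> has_derivative blinfun_apply (?D x)) (at x)" for x
    by (rule has_derivative_eq_rhs[OF P(1)]) (auto simp: blinfun.bilinear_simps snd_blinfun.rep_eq)
  moreover have "continuous_on UNIV ?D"
    using P by (intro continuous_intros)
  \<comment> \<open>The bump is nonzero only in the open box, so its support stays inside the closed
    one.\<close>
  moreover have "closure {x. ?\<eta> x \<noteq> 0} \<subseteq> cbox (a, c) (b, d)"
    using box_bump_outside(1)[OF assms(1,2)] box_subset_cbox
    by (intro closure_minimal closed_cbox) blast
  moreover from this have "compact (closure {x. ?\<eta> x \<noteq> 0})"
    by (metis bounded_cbox bounded_subset closed_closure compact_eq_bounded_closed)
  ultimately show ?thesis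
    unfolding C1c_on_def using assms(3) by (intro conjI exI[of _ ?D]) auto
qed

lemma C1c_on_scaleR_const:
  assumes "C1c_on \<Omega> (\<eta> :: real \<times> real \<Rightarrow> real)"
  shows "C1c_on \<Omega> (\<lambda>x. \<eta> x *\<^sub>R (v :: real \<times> real))"
proof -
  obtain D where D: "\<And>x. (\<eta> has_derivative blinfun_apply (D x)) (at x)" "continuous_on UNIV D"
    and c: "compact (closure {x. \<eta> x \<noteq> 0})" "closure {x. \<eta> x \<noteq> 0} \<subseteq> \<Omega>"
    using assms unfolding C1c_on_def by blast
  have sub: "closure {x. \<eta> x *\<^sub>R v \<noteq> 0} \<subseteq> closure {x. \<eta> x \<noteq> 0}"
    by (rule closure_mono) auto
  then have "compact (closure {x. \<eta> x *\<^sub>R v \<noteq> 0})"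
    using c(1) by (metis closed_closure compact_Int_closed inf.absorb_iff2)
  moreover have "((\<lambda>x. \<eta> x *\<^sub>R v) has_derivative blinfun_apply (blinfun_scaleR_left v o\<^sub>L D x)) (at x)" for x
    by (rule has_derivative_eq_rhs[OF has_derivative_scaleR_left[OF D(1)]]) auto
  moreover have "continuous_on UNIV (\<lambda>x. blinfun_scaleR_left v o\<^sub>L D x)"
    using D(2) by (intro bounded_bilinear.continuous_on[OF bounded_bilinear_blinfun_compose] continuous_intros)
  ultimately show ?thesis
    unfolding C1c_on_def using sub c(2) by (intro conjI exI[of _ "\<lambda>x. blinfun_scaleR_left v o\<^sub>L D x"]) auto
qed

section \<open>From the weak gradient to the classical one\<close>

lemma frechet_derivative_C1_partials:
  assumes "C1_partials U w p q" "x \<in> U"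
  shows "frechet_derivative w (at x) = (\<lambda>h. p x * fst h + q x * snd h)"
  using frechet_derivative_at[OF C1_partialsD(1)[OF assms]] by simp

text \<open>Both sides are integrals over the whole space of one and the same zero extension, so the
  equality also covers the default value of \<open>integral\<close>.\<close>

lemma integral_eq_of_zero_outside:
  fixes F :: "'a::euclidean_space \<Rightarrow> real"
  assumes "B \<subseteq> S" "\<And>x. x \<in> S \<Longrightarrow> x \<notin> B \<Longrightarrow> F x = 0"
  shows "integral S F = integral B F"
proof -
  have "(\<lambda>x. if x \<in> S then F x else 0) = (\<lambda>x. if x \<in> B then F x else 0)"
    using assms by (intro ext) auto
  then show ?thesis
    by (metis integral_restrict_UNIV)
qed

lemma box_bump_mult_integrable:
  assumes k: "k absolutely_integrable_on S" and S: "S \<in> sets lebesgue"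
  shows "(\<lambda>x. box_bump n l m x * (k x :: real)) integrable_on S"
proof -
  have "box_bump n l m \<in> borel_measurable (lebesgue_on S)"
    using C1_partialsD(4)[OF C1_partials_box_bump] S
    by (intro continuous_imp_measurable_on_sets_lebesgue) auto
  moreover have "bounded (box_bump n l m ` S)"
    unfolding bounded_iff using box_bump_bounds[of n l m] by (intro exI[of _ 1]) (simp add: abs_of_nonneg del: split_paired_All)
  ultimately have "(\<lambda>x. box_bump n l m x * k x) absolutely_integrable_on S"
    using k S by (intro absolutely_integrable_bounded_measurable_product[of "(*)"])
       (simp_all add: bilinear_conv_bounded_bilinear bounded_bilinear_mult)
  then show ?thesis by (simp add: set_lebesgue_integral_eq_integral(1))
qed

text \<open>The counterpart for merely integrable functions. Letting \<open>n\<close> grow turns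
  bumps into indicators, so the integral of \<open>k\<close> over every subbox is 0; Lebesgue
  differentiation then gives \<open>k\<close> = 0 almost everywhere.\<close>

lemma integral_zero_against_box_bumps_imp_zero:
  fixes k :: "real \<times> real \<Rightarrow> real"
  assumes k: "k absolutely_integrable_on cbox (a, c) (b, d)"
    and 0: "\<And>n a' b' c' d'. a' < b' \<Longrightarrow> c' < d' \<Longrightarrow> cbox (a', c') (b', d') \<subseteq> cbox (a, c) (b, d) \<Longrightarrow>
        integral (cbox (a', c') (b', d')) (\<lambda>x. box_bump n (a', c') (b', d') x * k x) = 0"
  shows "negligible {x \<in> cbox (a, c) (b, d). k x \<noteq> 0}"
proof -
  let ?Q = "cbox (a, c) (b, d)"
  have box0: "integral (cbox (a', c') (b', d')) k = 0"
    if le: "a' < b'" "c' < d'" and sub: "cbox (a', c') (b', d') \<subseteq> ?Q" for a' b' c' d'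
  proof -
    \<comment> \<open>The bumps tend to 1 only in the open box; passing between the open and the
      closed box does not change the integrals.\<close>
    let ?B = "box (a', c') (b', d')"
    have kB: "k absolutely_integrable_on ?B"
      using k sub box_subset_cbox by (meson lmeasurable_box fmeasurableD set_integrable_subset subset_trans)
    have "(\<lambda>n. integral ?B (\<lambda>x. box_bump n (a', c') (b', d') x * k x)) \<longlonglongrightarrow> integral ?B k"
    proof (rule dominated_convergence(2))
      fix n
      show "(\<lambda>x. box_bump n (a', c') (b', d') x * k x) integrable_on ?B"
        using kB by (rule box_bump_mult_integrable) auto
      fix x
      show "norm (box_bump n (a', c') (b', d') x * k x) \<le> \<bar>k x\<bar>"
        using box_bump_bounds by (simp add: abs_mult mult_left_le_one_le)
    next
      show "(\<lambda>x. \<bar>k x\<bar>) integrable_on ?B"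
        using kB by (simp add: absolutely_integrable_on_def)
      fix x assume "x \<in> ?B"
      from tendsto_mult[OF box_bump_tendsto_1[OF this] tendsto_const]
      show "(\<lambda>n. box_bump n (a', c') (b', d') x * k x) \<longlonglongrightarrow> k x" by simp
    qed
    moreover have "integral ?B (\<lambda>x. box_bump n (a', c') (b', d') x * k x) = 0" for n
      using 0[OF that] by (simp add: integral_open_interval)
    ultimately have "integral ?B k = 0"
      by (simp add: LIMSEQ_const_iff)
    then show ?thesis by (simp add: integral_open_interval)
  qed
  \<comment> \<open>The differentiation theorem asks for integrability on all boxes of the plane,
    hence the extension by zero.\<close>
  let ?K = "\<lambda>x. if x \<in> ?Q then k x else 0"
  have "?K integrable_on cbox p q" for p q
    using k by (intro integrable_on_subcbox[of _ UNIV])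
       (auto simp: integrable_restrict_UNIV set_lebesgue_integral_eq_integral(1))
  then obtain N where N: "negligible N"
    "\<And>x e. x \<notin> N \<Longrightarrow> 0 < e \<Longrightarrow> \<exists>\<delta>>0. \<forall>h. 0 < h \<and> h < \<delta> \<longrightarrow>
        norm (integral (cbox x (x + h *\<^sub>R One)) ?K /\<^sub>R h ^ DIM(real \<times> real) - ?K x) < e"
    using integrable_ccontinuous_explicit by blast
  have One: "(One :: real \<times> real) = (1, 1)"
    by (simp add: Basis_prod_def sum.union_disjoint disjoint_iff prod_eq_iff)
  have "k x = 0" if x: "x \<in> box (a, c) (b, d)" "x \<notin> N" for x
  proof (rule ccontr)
    assume "k x \<noteq> 0"
    then obtain \<delta> where \<delta>: "\<delta> > 0" "\<And>h. 0 < h \<Longrightarrow> h < \<delta> \<Longrightarrow>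
        norm (integral (cbox x (x + h *\<^sub>R One)) ?K /\<^sub>R h ^ DIM(real \<times> real) - ?K x) < \<bar>k x\<bar>"
      using N(2)[OF x(2), of "\<bar>k x\<bar>"] by auto
    obtain s y where xy: "x = (s, y)" by fastforce
    \<comment> \<open>Below \<delta> and small enough that the square with lower left corner
      \<open>x\<close> stays in \<open>?Q\<close>. Its integral is 0, so the mean would be within |k
      x| of \<open>k x\<close> strictly, which is absurd.\<close>
    define h where "h = min (\<delta> / 2) (min (b - s) (d - y))"
    have h: "0 < h" "h < \<delta>" "s + h \<le> b" "y + h \<le> d"
      using \<delta>(1) x(1) by (auto simp: xy h_def box_prod)
    have sub: "cbox (s, y) (s + h, y + h) \<subseteq> ?Q"
      using h x(1) by (auto simp: xy cbox_Pair_eq box_prod)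
    have "integral (cbox x (x + h *\<^sub>R One)) ?K = integral (cbox (s, y) (s + h, y + h)) k"
      using sub by (auto simp: xy One intro!: integral_cong)
    also have "\<dots> = 0" using box0[OF _ _ sub] h by simp
    finally show False using \<delta>(2)[OF h(1,2)] x(1) box_subset_cbox[of "(a, c)" "(b, d)"] by auto
  qed
  \<comment> \<open>The edges of \<open>?Q\<close>, where no such square need fit, form a null
    set.\<close>
  then have "{x \<in> ?Q. k x \<noteq> 0} \<subseteq> N \<union> (?Q - box (a, c) (b, d))" by blast
  then show ?thesis
    using N(1) negligible_frontier_interval[of "(a, c)" "(b, d)"] by (meson negligible_Un negligible_subset)
qed

text \<open>Against a bump, \<open>g\<close> and the classical partials satisfy the same integration
  by parts formula, so their difference integrates to 0 against every bump.\<close>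

lemma weak_gradient_eq_partials_ae:
  assumes \<Omega>: "open \<Omega>" and W: "W12_with_grad \<Omega> u g" and "U \<subseteq> \<Omega>"
    and u: "C1_partials U u u1 u2" and Q: "cbox (a, c) (b, d) \<subseteq> U"
  shows "negligible {x \<in> cbox (a, c) (b, d). g x \<noteq> (u1 x, u2 x)}"
proof -
  let ?Q = "cbox (a, c) (b, d)"
  have "g \<in> borel_measurable (lebesgue_on \<Omega>)"
  proof (rule measurable_on_imp_borel_measurable_lebesgue)
    show "g measurable_on \<Omega>" using W by (simp add: W12_with_grad_def)
    show "\<Omega> \<in> sets lebesgue" using \<Omega> by (intro sets_completionI_sets) simp
  qed
  then have gm: "g \<in> borel_measurable (lebesgue_on ?Q)"
    by (rule measurable_restrict_mono) (use Q \<open>U \<subseteq> \<Omega>\<close> in blast)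
  have "(\<lambda>x. (norm (g x))\<^sup>2) absolutely_integrable_on \<Omega>"
    using W unfolding W12_with_grad_def by (intro nonnegative_absolutely_integrable_1) simp_all
  then have "(\<lambda>x. (norm (g x))\<^sup>2) absolutely_integrable_on ?Q"
    using Q \<open>U \<subseteq> \<Omega>\<close> by (meson lmeasurable_cbox fmeasurableD set_integrable_subset subset_trans)
  \<comment> \<open>Square integrability gives integrability because the box has finite measure; 1 +
    |g|^2 is the dominating function.\<close>
  then have "(\<lambda>x. 1 + (norm (g x))\<^sup>2) integrable_on ?Q"
    by (intro integrable_add integrable_const) (simp add: set_lebesgue_integral_eq_integral(1))
  moreover have "norm (g x) \<le> 1 + (norm (g x))\<^sup>2" for x
    using sum_squares_bound[of "norm (g x)" 1] by (auto simp: power2_eq_square)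
       (smt (verit) mult_nonneg_nonneg norm_ge_zero)
  ultimately have g: "g absolutely_integrable_on ?Q"
    using gm by (intro measurable_bounded_by_integrable_imp_absolutely_integrable) auto
  have u1: "u1 absolutely_integrable_on ?Q" and u2: "u2 absolutely_integrable_on ?Q"
    using C1_partialsD(2,3)[OF u] Q
    by (auto intro!: absolutely_integrable_continuous intro: continuous_on_subset)
  have g1: "(\<lambda>x. fst (g x)) absolutely_integrable_on ?Q" and g2: "(\<lambda>x. snd (g x)) absolutely_integrable_on ?Q"
    using absolutely_integrable_linear[OF g bounded_linear_fst] absolutely_integrable_linear[OF g bounded_linear_snd]
    by (simp_all add: comp_def)
  have key: "integral (cbox (a', c') (b', d')) (\<lambda>x. box_bump n (a', c') (b', d') x * (fst (g x) - u1 x)) = 0"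
    "integral (cbox (a', c') (b', d')) (\<lambda>x. box_bump n (a', c') (b', d') x * (snd (g x) - u2 x)) = 0"
    if le: "a' < b'" "c' < d'" and sub: "cbox (a', c') (b', d') \<subseteq> ?Q" for n a' b' c' d'
  proof -
    let ?B = "cbox (a', c') (b', d')"
    let ?\<eta> = "box_bump n (a', c') (b', d')"
    let ?p = "box_bump_fst n (a', c') (b', d')"
    let ?q = "box_bump_snd n (a', c') (b', d')"
    have BU: "?B \<subseteq> U" using sub Q by blast
    have B\<Omega>: "?B \<subseteq> \<Omega>" using BU \<open>U \<subseteq> \<Omega>\<close> by blast
    note out = box_bump_outside[OF less_imp_le[OF le(1)] less_imp_le[OF le(2)]]
    have outB: "?\<eta> x = 0 \<and> ?p x = 0 \<and> ?q x = 0" if "x \<notin> ?B" for x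
      using out that box_subset_cbox by blast
    have C: "C1c_on \<Omega> ?\<eta>" using le B\<Omega> by (intro C1c_on_box_bump) auto
    have fd: "frechet_derivative ?\<eta> (at x) = (\<lambda>h. ?p x * fst h + ?q x * snd h)" for x
      by (rule frechet_derivative_C1_partials[OF C1_partials_box_bump UNIV_I])
    have wg: "integral \<Omega> (\<lambda>x. u x * (?p x * fst e + ?q x * snd e)) = - integral \<Omega> (\<lambda>x. ?\<eta> x * (g x \<bullet> e))"
      if "e \<in> Basis" for e
    proof -
      have "weak_gradient \<Omega> u g" using W by (simp add: W12_with_grad_def)
      then have "integral \<Omega> (\<lambda>x. u x * frechet_derivative ?\<eta> (at x) e) = - integral \<Omega> (\<lambda>x. ?\<eta> x * (g x \<bullet> e))"
        using C that unfolding weak_gradient_def by blast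
      then show ?thesis by (simp add: fd)
    qed
    have "integral \<Omega> (\<lambda>x. u x * ?p x) = - integral \<Omega> (\<lambda>x. ?\<eta> x * fst (g x))"
      using wg[of "(1, 0)"] by (simp add: Basis_prod_def inner_prod_def)
    moreover have "integral \<Omega> (\<lambda>x. u x * ?p x) = integral ?B (\<lambda>x. u x * ?p x)"
      "integral \<Omega> (\<lambda>x. ?\<eta> x * fst (g x)) = integral ?B (\<lambda>x. ?\<eta> x * fst (g x))"
      by (rule integral_eq_of_zero_outside[OF B\<Omega>], drule outB, simp)+
    ultimately have w1: "integral ?B (\<lambda>x. u x * ?p x) = - integral ?B (\<lambda>x. ?\<eta> x * fst (g x))" by simp
    have "integral \<Omega> (\<lambda>x. u x * ?q x) = - integral \<Omega> (\<lambda>x. ?\<eta> x * snd (g x))"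
      using wg[of "(0, 1)"] by (simp add: Basis_prod_def inner_prod_def)
    moreover have "integral \<Omega> (\<lambda>x. u x * ?q x) = integral ?B (\<lambda>x. u x * ?q x)"
      "integral \<Omega> (\<lambda>x. ?\<eta> x * snd (g x)) = integral ?B (\<lambda>x. ?\<eta> x * snd (g x))"
      by (rule integral_eq_of_zero_outside[OF B\<Omega>], drule outB, simp)+
    ultimately have w2: "integral ?B (\<lambda>x. u x * ?q x) = - integral ?B (\<lambda>x. ?\<eta> x * snd (g x))" by simp
    \<comment> \<open>The classical half: \<open>u\<close> times the bump vanishes off the open box,
      so each of its partials has integral 0. The term with the derivative of the bump is the one
      that the weak gradient formula evaluates.\<close>
    have "C1_partials U (\<lambda>x. u x * ?\<eta> x) (\<lambda>x. u1 x * ?\<eta> x + u x * ?p x) (\<lambda>x. u2 x * ?\<eta> x + u x * ?q x)"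
      by (rule C1_partials_mult[OF u C1_partials_box_bump])
    from integral_partials_eq_0[OF this BU] le out
    have ibp: "integral ?B (\<lambda>x. u1 x * ?\<eta> x + u x * ?p x) = 0" "integral ?B (\<lambda>x. u2 x * ?\<eta> x + u x * ?q x) = 0"
      by auto
    have contB: "continuous_on ?B f" if "continuous_on U f" for f :: "real \<times> real \<Rightarrow> real"
      using that BU by (rule continuous_on_subset)
    note cs = contB[OF C1_partialsD(2)[OF u]] contB[OF C1_partialsD(3)[OF u]] contB[OF C1_partialsD(4)[OF u]]
      C1_partialsD(2-4)[OF C1_partials_box_bump]
    have ii: "(\<lambda>x. u1 x * ?\<eta> x) integrable_on ?B" "(\<lambda>x. u x * ?p x) integrable_on ?B"
      "(\<lambda>x. u2 x * ?\<eta> x) integrable_on ?B" "(\<lambda>x. u x * ?q x) integrable_on ?B"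
      by (intro integrable_continuous continuous_on_mult cs)+
    have "(\<lambda>x. ?\<eta> x * k x) integrable_on ?B" if "k absolutely_integrable_on ?Q" for k :: "real \<times> real \<Rightarrow> real"
    proof -
      have "k absolutely_integrable_on ?B"
        using that sub by (meson lmeasurable_cbox fmeasurableD set_integrable_subset)
      then show ?thesis by (rule box_bump_mult_integrable) auto
    qed
    note ig = this[OF g1] this[OF g2]
    show "integral ?B (\<lambda>x. ?\<eta> x * (fst (g x) - u1 x)) = 0"
      using ibp(1) w1 ii ig by (simp add: integral_add integral_diff left_diff_distrib mult.commute)
    show "integral ?B (\<lambda>x. ?\<eta> x * (snd (g x) - u2 x)) = 0"
      using ibp(2) w2 ii ig by (simp add: integral_add integral_diff left_diff_distrib mult.commute)
  qed
  have "negligible {x \<in> ?Q. fst (g x) - u1 x \<noteq> 0}" "negligible {x \<in> ?Q. snd (g x) - u2 x \<noteq> 0}"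
    using key g1 g2 u1 u2 by (intro integral_zero_against_box_bumps_imp_zero set_integral_diff(1); blast)+
  then have "negligible ({x \<in> ?Q. fst (g x) - u1 x \<noteq> 0} \<union> {x \<in> ?Q. snd (g x) - u2 x \<noteq> 0})"
    by (rule negligible_Un)
  then show ?thesis by (rule negligible_subset) (auto simp: prod_eq_iff)
qed

subsection \<open>Harmonicity\<close>

text \<open>The partials are the derivative operators evaluated at (1, 0) and (0, 1). The mixed ones
  come out as two separate functions.\<close>

lemma C2_on_imp_C1_partials:
  assumes "C2_on U u"
  obtains u1 u2 u11 u12 u21 u22 where "C1_partials U u u1 u2"
    "C1_partials U u1 u11 u12" "C1_partials U u2 u21 u22"
proof -
  obtain Du :: "real \<times> real \<Rightarrow> (real \<times> real) \<Rightarrow>\<^sub>L real"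
    and D2u :: "real \<times> real \<Rightarrow> (real \<times> real) \<Rightarrow>\<^sub>L ((real \<times> real) \<Rightarrow>\<^sub>L real)"
    where Du: "\<And>x. x \<in> U \<Longrightarrow> (u has_derivative blinfun_apply (Du x)) (at x)"
      and D2u: "\<And>x. x \<in> U \<Longrightarrow> (Du has_derivative blinfun_apply (D2u x)) (at x)" "continuous_on U D2u"
    using assms unfolding C2_on_def by blast
  have cDu: "continuous_on U Du"
    using D2u(1) by (intro continuous_at_imp_continuous_on ballI has_derivative_continuous)
  have lin: "f h = f (1, 0) * fst h + f (0, 1) * snd h" if "bounded_linear f" for f :: "real \<times> real \<Rightarrow> real" and h
  proof -
    have "h = fst h *\<^sub>R (1, 0) + snd h *\<^sub>R (0, 1)" by (simp add: prod_eq_iff)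
    then have "f h = f (fst h *\<^sub>R (1, 0) + snd h *\<^sub>R (0, 1))" by (rule arg_cong)
    then show ?thesis
      by (simp add: linear_add[OF bounded_linear.linear[OF that]] linear_scale[OF bounded_linear.linear[OF that]]
          mult.commute del: scaleR_Pair)
  qed
  have "C1_partials U u (\<lambda>x. Du x (1, 0)) (\<lambda>x. Du x (0, 1))"
    unfolding C1_partials_def
  proof (intro conjI ballI)
    fix x assume "x \<in> U"
    show "(u has_derivative (\<lambda>h. Du x (1, 0) * fst h + Du x (0, 1) * snd h)) (at x)"
      by (rule has_derivative_eq_rhs[OF Du[OF \<open>x \<in> U\<close>]], rule ext, rule lin) (rule blinfun.bounded_linear_right)
  qed (intro continuous_intros cDu)+
  moreover have "C1_partials U (\<lambda>x. Du x e) (\<lambda>x. D2u x (1, 0) e) (\<lambda>x. D2u x (0, 1) e)" for e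
    unfolding C1_partials_def
  proof (intro conjI ballI)
    fix x assume x: "x \<in> U"
    have bl: "bounded_linear (\<lambda>A :: (real \<times> real) \<Rightarrow>\<^sub>L real. A e)"
      by (rule blinfun.bounded_linear_left)
    have "((\<lambda>x. Du x e) has_derivative (\<lambda>h. D2u x h e)) (at x)"
      by (rule bounded_linear.has_derivative[OF bl D2u(1)[OF x]])
    moreover have "(\<lambda>h. D2u x h e) = (\<lambda>h. D2u x (1, 0) e * fst h + D2u x (0, 1) e * snd h)"
      by (rule ext, rule lin) (rule bounded_linear_compose[OF bl blinfun.bounded_linear_right])
    ultimately show "((\<lambda>x. Du x e) has_derivative (\<lambda>h. D2u x (1, 0) e * fst h + D2u x (0, 1) e * snd h)) (at x)"
      by simp
  qed (intro continuous_intros D2u(2))+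
  ultimately show ?thesis using that by blast
qed

text \<open>For the test field bump times (v1, v2), the Dirichlet part of the formula is grad(bump)
  . (F, G) with (F, G) = |grad u|^2 v - 2 (grad u . v) grad u. Moving the derivative off the bump
  leaves the divergence of (F, G), which is -2 (Laplacian u) (grad u . v).\<close>

lemma inner_variation_of_box_bump:
  assumes \<Omega>: "open \<Omega>" and W: "W12_with_grad \<Omega> u g"
    and var: "\<And>\<phi>. C1c_on \<Omega> \<phi> \<Longrightarrow>
           integral \<Omega> (\<lambda>x. (norm (g x))\<^sup>2 * div2 \<phi> x
                             - 2 * (g x \<bullet> frechet_derivative \<phi> (at x) (g x)))
         + integral {x\<in>\<Omega>. snd x < x20}
             (\<lambda>x. (x20 - snd x) * indicator {y. u y < 0} x * div2 \<phi> x
                  - indicator {y. u y < 0} x * snd (\<phi> x))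
         + integral {x\<in>\<Omega>. snd x > x20}
             (\<lambda>x. (snd x - x20) * indicator {y. u y > 0} x * div2 \<phi> x
                  + indicator {y. u y > 0} x * snd (\<phi> x))
         = 0"
    and U: "open U" "U \<subseteq> {x \<in> \<Omega>. u x < 0 \<and> x20 < snd x}"
    and u: "C1_partials U u u1 u2"
    and u1: "C1_partials U u1 u11 u12" and u2: "C1_partials U u2 u21 u22"
    and le: "a < b" "c < d" and B: "cbox (a, c) (b, d) \<subseteq> U"
  shows "integral (cbox (a, c) (b, d)) (\<lambda>x. box_bump 1 (a, c) (b, d) x *
           ((u11 x + u22 x) * (u1 x * v1 + u2 x * v2))) = 0"
proof -
  let ?B = "cbox (a, c) (b, d)"
  let ?\<eta> = "box_bump 1 (a, c) (b, d)"
  let ?p = "box_bump_fst 1 (a, c) (b, d)"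
  let ?q = "box_bump_snd 1 (a, c) (b, d)"
  define \<phi> where "\<phi> x = ?\<eta> x *\<^sub>R (v1, v2)" for x
  note out = box_bump_outside[OF less_imp_le[OF le(1)] less_imp_le[OF le(2)]]
  have outB: "?\<eta> x = 0 \<and> ?p x = 0 \<and> ?q x = 0" if "x \<notin> ?B" for x
    using out that box_subset_cbox by blast
  have B\<Omega>: "?B \<subseteq> \<Omega>" using B U by blast
  have C: "C1c_on \<Omega> \<phi>"
    unfolding \<phi>_def using le B\<Omega> by (intro C1c_on_scaleR_const C1c_on_box_bump) auto
  have fd: "frechet_derivative \<phi> (at x) = (\<lambda>h. (?p x * fst h + ?q x * snd h) *\<^sub>R (v1, v2))" for x
    unfolding \<phi>_def
    by (rule frechet_derivative_at[symmetric])
       (rule has_derivative_scaleR_left[OF C1_partialsD(1)[OF C1_partials_box_bump UNIV_I]])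
  have dv: "div2 \<phi> x = ?p x * v1 + ?q x * v2" for x
    by (simp add: div2_def fd Basis_prod_def sum.union_disjoint disjoint_iff)
  \<comment> \<open>The box lies strictly above height \<open>x20\<close>, so the test field and its
    divergence vanish throughout this domain.\<close>
  have "integral {x\<in>\<Omega>. snd x < x20}
             (\<lambda>x. (x20 - snd x) * indicator {y. u y < 0} x * div2 \<phi> x
                  - indicator {y. u y < 0} x * snd (\<phi> x)) = integral {x\<in>\<Omega>. snd x < x20} (\<lambda>x. 0)"
  proof (rule integral_cong)
    fix x assume "x \<in> {x\<in>\<Omega>. snd x < x20}"
    then have "x \<notin> ?B" using B U by force
    then show "(x20 - snd x) * indicator {y. u y < 0} x * div2 \<phi> x
                  - indicator {y. u y < 0} x * snd (\<phi> x) = 0"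
      by (drule_tac outB) (simp add: dv \<phi>_def)
  qed
  \<comment> \<open>Here the box is inside the domain, but \<open>u\<close> < 0 on it and the
    integrand carries the indicator of {u > 0}.\<close>
  moreover have "integral {x\<in>\<Omega>. snd x > x20}
             (\<lambda>x. (snd x - x20) * indicator {y. u y > 0} x * div2 \<phi> x
                  + indicator {y. u y > 0} x * snd (\<phi> x)) = integral {x\<in>\<Omega>. snd x > x20} (\<lambda>x. 0)"
  proof (rule integral_cong)
    fix x
    show "(snd x - x20) * indicator {y. u y > 0} x * div2 \<phi> x
                  + indicator {y. u y > 0} x * snd (\<phi> x) = 0"
    proof (cases "x \<in> ?B")
      case True
      then have "u x < 0" using B U by blast
      then show ?thesis by simp
    next
      case False
      then show ?thesis by (drule_tac outB) (simp add: dv \<phi>_def)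
    qed
  qed
  moreover have "integral \<Omega> (\<lambda>x. (norm (g x))\<^sup>2 * div2 \<phi> x - 2 * (g x \<bullet> frechet_derivative \<phi> (at x) (g x)))
      = integral ?B (\<lambda>x. (norm (g x))\<^sup>2 * div2 \<phi> x - 2 * (g x \<bullet> frechet_derivative \<phi> (at x) (g x)))"
    by (rule integral_eq_of_zero_outside[OF B\<Omega>], drule outB, simp add: dv fd inner_prod_def)
  ultimately have I0: "integral ?B (\<lambda>x. (norm (g x))\<^sup>2 * div2 \<phi> x - 2 * (g x \<bullet> frechet_derivative \<phi> (at x) (g x))) = 0"
    using var[OF C] by simp
  \<comment> \<open>\<open>F\<close> and \<open>G\<close> are written as sums of constant multiples
    of products, and \<open>F1\<close>, \<open>G2\<close> are left unsimplified, so that the sum and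
    product rules for \<open>C1_partials\<close> match them literally. Only the two partials
    entering the divergence get explicit formulas.\<close>
  define F where "F x = - v1 * (u1 x * u1 x) + (v1 * (u2 x * u2 x) + - 2 * v2 * (u1 x * u2 x))" for x
  define G where "G x = v2 * (u1 x * u1 x) + (- v2 * (u2 x * u2 x) + - 2 * v1 * (u1 x * u2 x))" for x
  define F1 where "F1 x = - v1 * (u11 x * u1 x + u1 x * u11 x) + (v1 * (u21 x * u2 x + u2 x * u21 x)
      + - 2 * v2 * (u11 x * u2 x + u1 x * u21 x))" for x
  define G2 where "G2 x = v2 * (u12 x * u1 x + u1 x * u12 x) + (- v2 * (u22 x * u2 x + u2 x * u22 x)
      + - 2 * v1 * (u12 x * u2 x + u1 x * u22 x))" for x
  have "\<exists>F2. C1_partials U F F1 F2"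
    unfolding F_def[abs_def] F1_def[abs_def]
    by (rule exI) (rule C1_partials_add[OF C1_partials_cmult[OF C1_partials_mult[OF u1 u1]]
        C1_partials_add[OF C1_partials_cmult[OF C1_partials_mult[OF u2 u2]]
        C1_partials_cmult[OF C1_partials_mult[OF u1 u2]]]])
  then obtain F2 where F: "C1_partials U F F1 F2" by blast
  have "\<exists>G1. C1_partials U G G1 G2"
    unfolding G_def[abs_def] G2_def[abs_def]
    by (rule exI) (rule C1_partials_add[OF C1_partials_cmult[OF C1_partials_mult[OF u1 u1]]
        C1_partials_add[OF C1_partials_cmult[OF C1_partials_mult[OF u2 u2]]
        C1_partials_cmult[OF C1_partials_mult[OF u1 u2]]]])
  then obtain G1 where G: "C1_partials U G G1 G2" by blast
  \<comment> \<open>Agreement of \<open>g\<close> with the classical gradient off a null set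
    suffices under the integral.\<close>
  have "integral ?B (\<lambda>x. ?p x * F x + ?q x * G x) =
      integral ?B (\<lambda>x. (norm (g x))\<^sup>2 * div2 \<phi> x - 2 * (g x \<bullet> frechet_derivative \<phi> (at x) (g x)))"
  proof (rule integral_spike)
    show "negligible {x \<in> ?B. g x \<noteq> (u1 x, u2 x)}"
      using weak_gradient_eq_partials_ae[OF \<Omega> W _ u B] U by blast
    fix x assume "x \<in> ?B - {x \<in> ?B. g x \<noteq> (u1 x, u2 x)}"
    then have "g x = (u1 x, u2 x)" by blast
    then show "(norm (g x))\<^sup>2 * div2 \<phi> x - 2 * (g x \<bullet> frechet_derivative \<phi> (at x) (g x)) = ?p x * F x + ?q x * G x"
      by (simp add: fd dv F_def G_def norm_Pair power2_eq_square[symmetric])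
         (simp add: algebra_simps power2_eq_square)
  qed
  then have pq: "integral ?B (\<lambda>x. ?p x * F x + ?q x * G x) = 0" using I0 by simp
  have cont: "continuous_on ?B f" if "continuous_on U f" for f :: "real \<times> real \<Rightarrow> real"
    using that B by (rule continuous_on_subset)
  note cs = cont[OF C1_partialsD(2)[OF F]] cont[OF C1_partialsD(4)[OF F]] cont[OF C1_partialsD(3)[OF G]]
    cont[OF C1_partialsD(4)[OF G]] C1_partialsD(2-4)[OF C1_partials_box_bump[of ?B]]
  have ii: "(\<lambda>x. ?p x * F x) integrable_on ?B" "(\<lambda>x. ?\<eta> x * F1 x) integrable_on ?B"
    "(\<lambda>x. ?q x * G x) integrable_on ?B" "(\<lambda>x. ?\<eta> x * G2 x) integrable_on ?B"
    by (intro integrable_continuous continuous_on_mult cs)+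
  have "integral ?B (\<lambda>x. ?p x * F x + ?\<eta> x * F1 x) = 0"
    by (rule integral_partials_eq_0(1)[OF C1_partials_mult[OF C1_partials_box_bump F] B])
       (use le out in auto)
  moreover have "integral ?B (\<lambda>x. ?q x * G x + ?\<eta> x * G2 x) = 0"
    by (rule integral_partials_eq_0(2)[OF C1_partials_mult[OF C1_partials_box_bump G] B])
       (use le out in auto)
  ultimately have "integral ?B (\<lambda>x. ?\<eta> x * F1 x + ?\<eta> x * G2 x) = 0"
    using pq ii by (simp add: integral_add)
  \<comment> \<open>Once \<open>u12\<close> = \<open>u21\<close>, the mixed terms cancel and the
    divergence factors.\<close>
  moreover have "integral ?B (\<lambda>x. ?\<eta> x * F1 x + ?\<eta> x * G2 x) =
     integral ?B (\<lambda>x. - 2 * (?\<eta> x * ((u11 x + u22 x) * (u1 x * v1 + u2 x * v2))))"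
  proof (rule integral_cong)
    fix x assume "x \<in> ?B"
    then have "u12 x = u21 x" using mixed_partials_eq[OF U(1) u u1 u2] B by blast
    then show "?\<eta> x * F1 x + ?\<eta> x * G2 x = - 2 * (?\<eta> x * ((u11 x + u22 x) * (u1 x * v1 + u2 x * v2)))"
      unfolding F1_def G2_def by (simp add: algebra_simps)
  qed
  ultimately show ?thesis by simp
qed

lemma C1_partials_zero_on_open:
  assumes w: "C1_partials U w p q" and "open V" "V \<subseteq> U" "z \<in> V" and 0: "\<And>x. x \<in> V \<Longrightarrow> w x = 0"
  shows "p z = 0" "q z = 0"
proof -
  have "((\<lambda>x. 0) has_derivative (\<lambda>h. p z * fst h + q z * snd h)) (at z)"
    by (rule has_derivative_transform_within_open[OF C1_partialsD(1)[OF w] \<open>open V\<close> \<open>z \<in> V\<close>])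
       (use assms(3,4) 0 in blast)+
  then have "(\<lambda>h. p z * fst h + q z * snd h) = (\<lambda>h. 0)"
    by (rule has_derivative_unique) simp
  from fun_cong[OF this, of "(1, 0)"] fun_cong[OF this, of "(0, 1)"]
  show "p z = 0" "q z = 0" by simp_all
qed

lemma weak_solution_harmonic:
  assumes \<Omega>: "open \<Omega>" and sol: "weak_solution \<Omega> x20 u"
  obtains u1 u2 u11 u12 u21 u22 where
    "C1_partials {x \<in> \<Omega>. u x < 0 \<and> x20 < snd x} u u1 u2"
    "C1_partials {x \<in> \<Omega>. u x < 0 \<and> x20 < snd x} u1 u11 u12"
    "C1_partials {x \<in> \<Omega>. u x < 0 \<and> x20 < snd x} u2 u21 u22"
    "\<And>x. x \<in> \<Omega> \<Longrightarrow> u x < 0 \<Longrightarrow> x20 < snd x \<Longrightarrow> u11 x + u22 x = 0"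
proof -
  let ?U = "{x \<in> \<Omega>. u x < 0 \<and> x20 < snd x}"
  obtain g where W: "W12_with_grad \<Omega> u g" and contu: "continuous_on \<Omega> u" and C2: "C2_on {x\<in>\<Omega>. u x \<noteq> 0} u"
    and var: "\<And>\<phi>. C1c_on \<Omega> \<phi> \<Longrightarrow>
           integral \<Omega> (\<lambda>x. (norm (g x))\<^sup>2 * div2 \<phi> x
                             - 2 * (g x \<bullet> frechet_derivative \<phi> (at x) (g x)))
         + integral {x\<in>\<Omega>. snd x < x20}
             (\<lambda>x. (x20 - snd x) * indicator {y. u y < 0} x * div2 \<phi> x
                  - indicator {y. u y < 0} x * snd (\<phi> x))
         + integral {x\<in>\<Omega>. snd x > x20}
             (\<lambda>x. (snd x - x20) * indicator {y. u y > 0} x * div2 \<phi> x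
                  + indicator {y. u y > 0} x * snd (\<phi> x))
         = 0"
    using sol unfolding weak_solution_def by blast
  obtain u1 u2 u11 u12 u21 u22 where P: "C1_partials {x\<in>\<Omega>. u x \<noteq> 0} u u1 u2"
    "C1_partials {x\<in>\<Omega>. u x \<noteq> 0} u1 u11 u12" "C1_partials {x\<in>\<Omega>. u x \<noteq> 0} u2 u21 u22"
    using C2_on_imp_C1_partials[OF C2] .
  have sub: "?U \<subseteq> {x\<in>\<Omega>. u x \<noteq> 0}" by auto
  note P = P[THEN C1_partials_subset, OF sub]
  have "open (\<Omega> \<inter> u -` {..<0})" using contu \<Omega> by (intro continuous_open_preimage) auto
  moreover have "open {x :: real \<times> real. x20 < snd x}"
    by (intro open_Collect_less continuous_intros)
  ultimately have "open ((\<Omega> \<inter> u -` {..<0}) \<inter> {x. x20 < snd x})" by (rule open_Int)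
  moreover have "(\<Omega> \<inter> u -` {..<0}) \<inter> {x. x20 < snd x} = ?U" by auto
  ultimately have U: "open ?U" by simp
  have prod0: "(u11 x + u22 x) * (u1 x * v1 + u2 x * v2) = 0" if "x \<in> ?U" for x v1 v2
  \<comment> \<open>Index 1 because the bump of index 0 is identically zero and would be no positive
    weight.\<close>
  proof (rule weighted_box_integrals_zero_imp_zero[OF U _ _ _ _ that, where \<eta>="box_bump 1"])
    show "continuous_on ?U (\<lambda>x. (u11 x + u22 x) * (u1 x * v1 + u2 x * v2))"
      using C1_partialsD(2-4)[OF P(2)] C1_partialsD(2-4)[OF P(3)] by (intro continuous_intros)
    show "continuous_on UNIV (box_bump 1 l m)" for l m
      by (rule C1_partialsD(4)[OF C1_partials_box_bump])
    show "0 < box_bump 1 l m x" if "x \<in> box l m" for l m x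
      using box_bump_pos[OF that] by simp
    fix a b c d :: real
    assume "a < b" "c < d" "cbox (a, c) (b, d) \<subseteq> ?U"
    then show "integral (cbox (a, c) (b, d)) (\<lambda>x. box_bump 1 (a, c) (b, d) x *
        ((u11 x + u22 x) * (u1 x * v1 + u2 x * v2))) = 0"
      by - (rule inner_variation_of_box_bump[OF \<Omega> W _ U order.refl P]; (erule var | assumption))
  qed
  have "u11 z + u22 z = 0" if z: "z \<in> ?U" for z
  proof (rule ccontr)
    assume nz: "u11 z + u22 z \<noteq> 0"
    let ?V = "?U \<inter> (\<lambda>x. u11 x + u22 x) -` (- {0})"
    have V: "open ?V"
      using C1_partialsD(2)[OF P(2)] C1_partialsD(3)[OF P(3)] U
      by (intro continuous_open_preimage continuous_intros) auto
    have zV: "z \<in> ?V" using z nz by simp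
    have "u1 x = 0" "u2 x = 0" if "x \<in> ?V" for x
      using prod0[of x 1 0] prod0[of x 0 1] that by auto
    then have "u11 z = 0" "u22 z = 0"
      using C1_partials_zero_on_open[OF P(2) V _ zV] C1_partials_zero_on_open[OF P(3) V _ zV] by blast+
    then show False using nz by simp
  qed
  then show ?thesis using that[OF P] by blast
qed

subsection \<open>Interior balls\<close>

text \<open>Hoelder continuity bounds the second derivative on the unit interval around
  \<open>a\<close>; two mean value estimates then give a Taylor bound with \<open>m\<close> the
  slope at \<open>a\<close>. The touching ball needs no more than this from the curve.\<close>

lemma C2alpha_quadratic_bound:
  assumes "C2alpha \<alpha> f" and "0 < \<alpha>"
  obtains m K where "K > 0" "\<And>s. \<bar>s - a\<bar> \<le> 1 \<Longrightarrow> \<bar>f s - f a - m * (s - a)\<bar> \<le> K * (s - a)\<^sup>2"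
proof -
  obtain f' f'' C where f: "\<And>s. (f has_real_derivative f' s) (at s)"
    and f': "\<And>s. (f' has_real_derivative f'' s) (at s)"
    and C: "\<And>s t. \<bar>f'' s - f'' t\<bar> \<le> C * \<bar>s - t\<bar> powr \<alpha>"
    using assms(1) unfolding C2alpha_def by blast
  \<comment> \<open>On this interval |s - a| to the power \<alpha> is at most 1; the summand 1 makes
    the bound positive.\<close>
  define M where "M = \<bar>f'' a\<bar> + \<bar>C\<bar> + 1"
  have f''M: "\<bar>f'' s\<bar> \<le> M" if "\<bar>s - a\<bar> \<le> 1" for s
  proof -
    have "\<bar>s - a\<bar> powr \<alpha> \<le> 1"
      using that assms(2) powr_mono2[of \<alpha> "\<bar>s - a\<bar>" 1] by simp
    then have "C * \<bar>s - a\<bar> powr \<alpha> \<le> \<bar>C\<bar> * 1"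
      by (intro mult_mono) auto
    then show ?thesis using C[of s a] by (simp add: M_def)
  qed
  have f'M: "\<bar>f' s - f' a\<bar> \<le> M * \<bar>s - a\<bar>" if "\<bar>s - a\<bar> \<le> 1" for s
  proof -
    have "norm (f' s - f' a) \<le> M * norm (s - a)"
      by (rule field_differentiable_bound[of "cball a 1" f' f''])
         (use f' f''M that in \<open>auto simp: dist_real_def abs_minus_commute intro: has_field_derivative_at_within\<close>)
    then show ?thesis by simp
  qed
  have "\<bar>f s - f a - f' a * (s - a)\<bar> \<le> M * (s - a)\<^sup>2" if s: "\<bar>s - a\<bar> \<le> 1" for s
  proof -
    have "norm ((f s - f' a * s) - (f a - f' a * a)) \<le> (M * \<bar>s - a\<bar>) * norm (s - a)"
    proof (rule field_differentiable_bound[of "cball a \<bar>s - a\<bar>" "\<lambda>s. f s - f' a * s" "\<lambda>s. f' s - f' a"])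
      fix t assume t: "t \<in> cball a \<bar>s - a\<bar>"
      show "((\<lambda>s. f s - f' a * s) has_real_derivative f' t - f' a) (at t within cball a \<bar>s - a\<bar>)"
        by (auto intro!: derivative_eq_intros has_field_derivative_at_within[OF f])
      have ts: "\<bar>t - a\<bar> \<le> \<bar>s - a\<bar>" using t by (simp add: dist_real_def abs_minus_commute)
      then have "\<bar>f' t - f' a\<bar> \<le> M * \<bar>t - a\<bar>" using s by (intro f'M) simp
      also have "\<dots> \<le> M * \<bar>s - a\<bar>" using ts by (intro mult_left_mono) (auto simp: M_def)
      finally show "norm (f' t - f' a) \<le> M * \<bar>s - a\<bar>" by simp
    qed (auto simp: dist_real_def abs_minus_commute)
    then show ?thesis by (simp add: power2_eq_square algebra_simps)
  qed
  moreover have "M > 0" by (simp add: M_def)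
  ultimately show ?thesis using that by blast
qed

text \<open>A small ball tangent to the graph at \<open>x0\<close> lies above it, since its
  curvature beats the quadratic bound. Points strictly above the graph near \<open>x0\<close> avoid
  the frontier of \<open>S\<close>, so membership in \<open>S\<close> spreads from one point of
  \<open>S\<close> along connected sets. The abstract orthonormal frame allows reuse with
  \<open>n\<close> reversed.\<close>

lemma interior_ball_above_graph:
  fixes S :: "'a::real_inner set" and e n :: 'a
  assumes basis: "e \<bullet> e = 1" "n \<bullet> n = 1" "e \<bullet> n = 0" "\<And>x. x = (e \<bullet> x) *\<^sub>R e + (n \<bullet> x) *\<^sub>R n"
    and fr: "\<And>x. x \<in> ball x0 r \<Longrightarrow> x \<in> frontier S \<Longrightarrow> n \<bullet> x = f (e \<bullet> x)"
    and "r > 0" and fx0: "n \<bullet> x0 = f (e \<bullet> x0)"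
    and K: "K > 0" "\<And>s. \<bar>s - e \<bullet> x0\<bar> \<le> 1 \<Longrightarrow>
          \<bar>f s - f (e \<bullet> x0) - m * (s - e \<bullet> x0)\<bar> \<le> K * (s - e \<bullet> x0)\<^sup>2"
    and near: "\<And>\<epsilon>. \<epsilon> > 0 \<Longrightarrow> \<exists>p\<in>S. dist x0 p < \<epsilon> \<and> f (e \<bullet> p) < n \<bullet> p"
  obtains z R where "0 < R" "R < r" "ball z R \<subseteq> S" "dist z x0 = R"
proof -
  define a where "a = e \<bullet> x0"
  define N where "N = sqrt (1 + m\<^sup>2)"
  have N: "N \<ge> 1" "N\<^sup>2 = 1 + m\<^sup>2" by (auto simp: N_def)
  \<comment> \<open>The first bound gives 4 * R <= min 1 r, keeping the ball in
    \<open>ball x0 r\<close> and in the range of the Taylor bound; the second gives 2 * \<rho> * K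
    <= 1.\<close>
  define \<rho> where "\<rho> = min (min 1 r / (4 * N)) (1 / (2 * K))"
  have \<rho>: "\<rho> > 0" "\<rho> * N \<le> min 1 r / 4" "2 * \<rho> * K \<le> 1"
  proof -
    show "\<rho> > 0" using N \<open>r > 0\<close> K by (simp add: \<rho>_def)
    have "\<rho> * N \<le> min 1 r / (4 * N) * N" using N by (intro mult_right_mono) (auto simp: \<rho>_def)
    then show "\<rho> * N \<le> min 1 r / 4" using N by simp
    have "\<rho> * (2 * K) \<le> 1 / (2 * K) * (2 * K)" using K by (intro mult_right_mono) (auto simp: \<rho>_def)
    then show "2 * \<rho> * K \<le> 1" using K by (simp add: mult.commute mult.left_commute)
  qed
  define R where "R = \<rho> * N"
  \<comment> \<open>\<open>n - m *\<^sub>R e\<close> is orthogonal to the tangent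
    \<open>e + m *\<^sub>R n\<close> and has length \<open>N\<close>, so \<open>x0\<close> lies on
    the sphere of radius \<open>R\<close> about \<open>z\<close>.\<close>
  define z where "z = x0 + \<rho> *\<^sub>R (n - m *\<^sub>R e)"
  have R: "R > 0" "4 * R \<le> 1" "4 * R \<le> r" "\<rho> \<le> R"
    using \<rho> N by (auto simp: R_def)
  have ne: "n \<bullet> e = 0" using basis(3) by (simp add: inner_commute)
  have norm2: "(norm x)\<^sup>2 = (e \<bullet> x)\<^sup>2 + (n \<bullet> x)\<^sup>2" for x
    by (subst power2_norm_eq_inner, subst (2) basis(4)[of x])
       (simp add: inner_add_right inner_commute power2_eq_square)
  have norm_le: "norm x \<le> \<bar>e \<bullet> x\<bar> + \<bar>n \<bullet> x\<bar>" for x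
  proof -
    have "norm x = norm ((e \<bullet> x) *\<^sub>R e + (n \<bullet> x) *\<^sub>R n)" using basis(4)[of x] by simp
    also have "\<dots> \<le> norm ((e \<bullet> x) *\<^sub>R e) + norm ((n \<bullet> x) *\<^sub>R n)" by (rule norm_triangle_ineq)
    finally show ?thesis using basis by (simp add: norm_eq_sqrt_inner)
  qed
  have comp_le: "\<bar>e \<bullet> x\<bar> \<le> norm x" "\<bar>n \<bullet> x\<bar> \<le> norm x" for x
    using Cauchy_Schwarz_ineq2[of e x] Cauchy_Schwarz_ineq2[of n x] basis by (simp_all add: norm_eq_sqrt_inner)
  have f_le: "f s \<le> n \<bullet> x0 + m * (s - a) + K * (s - a)\<^sup>2" if "\<bar>s - a\<bar> \<le> 1" for s
    using K(2)[of s] that fx0 unfolding a_def by linarith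
  have dz: "dist z x0 = R"
  proof -
    have "(norm (\<rho> *\<^sub>R (n - m *\<^sub>R e)))\<^sup>2 = R\<^sup>2"
      using basis ne by (simp add: norm2 inner_diff_right R_def power_mult_distrib N algebra_simps)
    then have "norm (\<rho> *\<^sub>R (n - m *\<^sub>R e)) = R"
      using R(1) by (simp add: power2_eq_iff_nonneg)
    then show ?thesis by (simp add: z_def dist_norm)
  qed
  \<comment> \<open>A connected set meeting both \<open>S\<close> and its complement meets the
    frontier, which near \<open>x0\<close> lies on the graph.\<close>
  have above_S: "A \<subseteq> S"
    if "connected A" "A \<inter> S \<noteq> {}" "A \<subseteq> ball x0 r" "\<And>x. x \<in> A \<Longrightarrow> f (e \<bullet> x) < n \<bullet> x" for A
  proof (rule ccontr)
    assume "\<not> A \<subseteq> S"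
    then have "A \<inter> frontier S \<noteq> {}" using that by (intro connected_Int_frontier) auto
    then obtain x where "x \<in> A" "x \<in> frontier S" by blast
    then show False using fr[of x] that(3,4) by force
  qed
  have ball_above: "f (e \<bullet> x) < n \<bullet> x" and ball_sub: "x \<in> ball x0 r" if x: "x \<in> ball z R" for x
  proof -
    define \<sigma> \<tau> where "\<sigma> = e \<bullet> (x - x0)" and "\<tau> = n \<bullet> (x - x0)"
    have "dist x0 x \<le> dist x0 z + dist z x" by (rule dist_triangle)
    also have "\<dots> < 2 * R" using x dz by (simp add: dist_commute)
    finally have d: "dist x0 x < 2 * R" .
    then show "x \<in> ball x0 r" using R by simp
    have \<sigma>: "\<bar>\<sigma>\<bar> \<le> 1"
      using comp_le(1)[of "x - x0"] d R by (simp add: \<sigma>_def dist_norm norm_minus_commute)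
    have "(norm (x - z))\<^sup>2 < R\<^sup>2"
      using x R(1) by (intro power_strict_mono) (auto simp: dist_norm norm_minus_commute)
    moreover have "(norm (x - z))\<^sup>2 = (\<sigma> + \<rho> * m)\<^sup>2 + (\<tau> - \<rho>)\<^sup>2"
      unfolding norm2 using basis ne by (simp add: z_def \<sigma>_def \<tau>_def inner_diff_right inner_add_right)
        (simp add: algebra_simps)
    moreover have "R\<^sup>2 = \<rho>\<^sup>2 * (1 + m\<^sup>2)" by (simp add: R_def power_mult_distrib N)
    \<comment> \<open>The condition |x - z| < R in frame coordinates relative to \<open>x0\<close>,
      with \<rho>^2 (1 + m^2) cancelled on both sides.\<close>
    ultimately have "\<sigma>\<^sup>2 + \<tau>\<^sup>2 < 2 * \<rho> * (\<tau> - m * \<sigma>)"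
      by (simp add: power2_eq_square algebra_simps)
    moreover have "2 * \<rho> * (K * \<sigma>\<^sup>2) \<le> \<sigma>\<^sup>2"
      using mult_right_mono[OF \<rho>(3), of "\<sigma>\<^sup>2"] by (simp add: mult.assoc)
    ultimately have "2 * \<rho> * (K * \<sigma>\<^sup>2) < 2 * \<rho> * (\<tau> - m * \<sigma>)"
      using zero_le_power2[of \<tau>] by linarith
    then have "m * \<sigma> + K * \<sigma>\<^sup>2 < \<tau>" using \<rho>(1) by simp
    then show "f (e \<bullet> x) < n \<bullet> x"
      using f_le[of "e \<bullet> x"] \<sigma> by (simp add: \<sigma>_def \<tau>_def a_def inner_diff_right)
  qed
  \<comment> \<open>Chosen so that over the interval of half-width \<epsilon> about \<open>a\<close>
    the graph stays below the height \<rho> above \<open>x0\<close>.\<close>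
  define \<epsilon> where "\<epsilon> = min \<rho> (\<rho> / (2 * (\<bar>m\<bar> + K)))"
  have \<epsilon>: "0 < \<epsilon>" "\<epsilon> \<le> \<rho>" "(\<bar>m\<bar> + K) * \<epsilon> < \<rho>"
  proof -
    have mK: "\<bar>m\<bar> + K > 0" using K by simp
    show "0 < \<epsilon>" using \<rho>(1) mK by (simp add: \<epsilon>_def)
    show "\<epsilon> \<le> \<rho>" by (simp add: \<epsilon>_def)
    have "(\<bar>m\<bar> + K) * \<epsilon> \<le> (\<bar>m\<bar> + K) * (\<rho> / (2 * (\<bar>m\<bar> + K)))"
      using mK by (intro mult_left_mono) (auto simp: \<epsilon>_def)
    also have "\<dots> = \<rho> / 2" using mK by (simp add: field_simps)
    finally show "(\<bar>m\<bar> + K) * \<epsilon> < \<rho>" using \<rho>(1) by simp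
  qed
  have low: "f s < n \<bullet> x0 + \<rho>" if s: "\<bar>s - a\<bar> \<le> \<epsilon>" for s
  proof -
    have s1: "\<bar>s - a\<bar> \<le> 1" using s \<epsilon> R by linarith
    have "m * (s - a) \<le> \<bar>m\<bar> * \<epsilon>"
    proof -
      have "m * (s - a) \<le> \<bar>m\<bar> * \<bar>s - a\<bar>" by (simp flip: abs_mult)
      also have "\<dots> \<le> \<bar>m\<bar> * \<epsilon>" using s by (intro mult_left_mono) auto
      finally show ?thesis .
    qed
    moreover have "(s - a)\<^sup>2 \<le> \<bar>s - a\<bar>"
      using s1 mult_left_le_one_le[of "\<bar>s - a\<bar>" "\<bar>s - a\<bar>"] by (simp add: power2_eq_square flip: abs_mult)
    then have "K * (s - a)\<^sup>2 \<le> K * \<epsilon>" using s K by (intro mult_left_mono) auto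
    ultimately show ?thesis using f_le[OF s1] \<epsilon>(3) by (simp add: algebra_simps)
  qed
  obtain p where p: "p \<in> S" "dist x0 p < \<epsilon>" "f (e \<bullet> p) < n \<bullet> p" using near[OF \<epsilon>(1)] by blast
  have pe: "\<bar>e \<bullet> p - a\<bar> < \<epsilon>" and pn: "\<bar>n \<bullet> p - n \<bullet> x0\<bar> < \<epsilon>"
    using comp_le[of "p - x0"] p(2) by (simp_all add: a_def dist_norm norm_minus_commute inner_diff_right)
  \<comment> \<open>The path into the ball: from \<open>p\<close> vertically to \<open>p'\<close>,
    horizontally to \<open>q\<close>, which lies over \<open>x0\<close> inside the ball. Segments
    \<open>?A\<close> and \<open>?H\<close> carry the two moves; the ball itself is the third
    connected set.\<close>
  define p' where "p' = (e \<bullet> p) *\<^sub>R e + (n \<bullet> x0 + \<rho>) *\<^sub>R n"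
  define q where "q = a *\<^sub>R e + (n \<bullet> x0 + \<rho>) *\<^sub>R n"
  have coords: "e \<bullet> p' = e \<bullet> p" "n \<bullet> p' = n \<bullet> x0 + \<rho>" "e \<bullet> q = a" "n \<bullet> q = n \<bullet> x0 + \<rho>"
    using basis ne by (simp_all add: p'_def q_def inner_add_right)
  have in_ball: "x \<in> ball x0 r" if "\<bar>e \<bullet> x - a\<bar> \<le> \<epsilon>" "\<bar>n \<bullet> x - n \<bullet> x0\<bar> \<le> \<rho>" for x
    using norm_le[of "x - x0"] that \<epsilon> R
    by (simp add: a_def dist_norm norm_minus_commute inner_diff_right)
  let ?A = "{x. e \<bullet> x = e \<bullet> p} \<inter> {x. n \<bullet> x > f (e \<bullet> p)} \<inter> {x. n \<bullet> x \<le> n \<bullet> x0 + \<rho>} \<inter> {x. n \<bullet> x \<ge> n \<bullet> x0 - \<rho>}"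
  have "?A \<subseteq> S"
  proof (rule above_S)
    show "connected ?A"
      by (intro convex_connected convex_Int convex_hyperplane convex_halfspace_gt convex_halfspace_le convex_halfspace_ge)
    show "?A \<inter> S \<noteq> {}" using p pn \<epsilon> by auto
    show "?A \<subseteq> ball x0 r" using in_ball pe by auto
  qed auto
  moreover have "p' \<in> ?A" using coords low[of "e \<bullet> p"] pe \<rho>(1) by auto
  ultimately have p': "p' \<in> S" by blast
  let ?H = "{x. n \<bullet> x = n \<bullet> x0 + \<rho>} \<inter> {x. e \<bullet> x \<le> a + \<epsilon>} \<inter> {x. e \<bullet> x \<ge> a - \<epsilon>}"
  have "?H \<subseteq> S"
  proof (rule above_S)
    show "connected ?H"
      by (intro convex_connected convex_Int convex_hyperplane convex_halfspace_le convex_halfspace_ge)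
    show "?H \<inter> S \<noteq> {}" using p' coords pe by auto
    show "?H \<subseteq> ball x0 r" using in_ball \<rho>(1) by auto
    show "f (e \<bullet> x) < n \<bullet> x" if "x \<in> ?H" for x using low[of "e \<bullet> x"] that by auto
  qed
  moreover have "q \<in> ?H" using coords \<epsilon>(1) by simp
  ultimately have "q \<in> S" by blast
  moreover have "q \<in> ball z R"
  proof -
    \<comment> \<open>The offset has length \<rho> * |m|, which is less than R = \<rho> * N because
      N^2 = 1 + m^2.\<close>
    have "q - z = (\<rho> * m) *\<^sub>R e"
      using basis(4)[of x0] by (simp add: q_def z_def a_def algebra_simps)
    then have "norm (q - z) = \<rho> * \<bar>m\<bar>" using basis \<rho>(1) by (simp add: norm_eq_sqrt_inner[of e] abs_mult)
    moreover have "\<bar>m\<bar> < N"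
      unfolding N_def by (rule real_less_rsqrt) simp
    ultimately show ?thesis using \<rho>(1) by (simp add: R_def dist_norm norm_minus_commute)
  qed
  ultimately have "ball z R \<subseteq> S"
    using ball_above ball_sub by (intro above_S) auto
  then show ?thesis using that[of R z] R dz \<open>r > 0\<close> by simp
qed

text \<open>\<open>S\<close> accumulates at \<open>x0\<close> from above the graph or, failing that,
  from below. The second case is the first one for the reflected frame, with \<open>- n\<close>,
  \<open>- f\<close> and \<open>- m\<close>.\<close>

lemma interior_ball_C2alpha_curve:
  assumes "open S" and x0: "x0 \<in> frontier S" "x0 \<in> \<Omega>"
    and curve: "locally_C2alpha_curve \<alpha> (frontier S) \<Omega>" and "0 < \<alpha>" and "\<delta> > 0"
  obtains z R where "0 < R" "R < \<delta>" "ball z R \<subseteq> S" "dist z x0 = R"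
proof -
  obtain r' \<theta> f where r': "r' > 0" and f: "C2alpha \<alpha> f"
    and graph: "frontier S \<inter> ball x0 r' = {x \<in> ball x0 r'. rot2 \<theta> x = f (rot1 \<theta> x)}"
    using curve x0 unfolding locally_C2alpha_curve_def by blast
  define e n where "e = (cos \<theta>, sin \<theta>)" and "n = (- sin \<theta>, cos \<theta>)"
  have rot: "rot1 \<theta> x = e \<bullet> x" "rot2 \<theta> x = n \<bullet> x" for x
    by (simp_all add: rot1_def rot2_def e_def n_def inner_prod_def)
  have sc: "cos \<theta> * cos \<theta> + sin \<theta> * sin \<theta> = 1" "sin \<theta> * sin \<theta> + cos \<theta> * cos \<theta> = 1"
    using sin_cos_squared_add[of \<theta>] by (simp_all add: power2_eq_square)
  have basis: "e \<bullet> e = 1" "n \<bullet> n = 1" "e \<bullet> n = 0" "x = (e \<bullet> x) *\<^sub>R e + (n \<bullet> x) *\<^sub>R n" for x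
  proof -
    show "e \<bullet> e = 1" "n \<bullet> n = 1" "e \<bullet> n = 0" using sc by (simp_all add: e_def n_def inner_prod_def)
    obtain s y where x: "x = (s, y)" by fastforce
    have "(cos \<theta> * s + sin \<theta> * y) * cos \<theta> + (- sin \<theta> * s + cos \<theta> * y) * - sin \<theta> = s"
      "(cos \<theta> * s + sin \<theta> * y) * sin \<theta> + (- sin \<theta> * s + cos \<theta> * y) * cos \<theta> = y"
      using sc(1) by algebra+
    then show "x = (e \<bullet> x) *\<^sub>R e + (n \<bullet> x) *\<^sub>R n"
      using sc by (simp add: e_def n_def inner_prod_def x)
  qed
  \<comment> \<open>The ball lemma yields R < r, so this cap delivers R < \<delta>.\<close>
  define r where "r = min r' \<delta>"
  have r: "r > 0" "r \<le> r'" "r \<le> \<delta>" using r' \<open>\<delta> > 0\<close> by (auto simp: r_def)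
  have fr: "n \<bullet> x = f (e \<bullet> x)" if "x \<in> ball x0 r" "x \<in> frontier S" for x
  proof -
    have "x \<in> frontier S \<inter> ball x0 r'" using that r by auto
    then show ?thesis using graph rot by auto
  qed
  have fx0: "n \<bullet> x0 = f (e \<bullet> x0)" using fr x0 r by simp
  obtain m K where K: "K > 0" "\<And>s. \<bar>s - e \<bullet> x0\<bar> \<le> 1 \<Longrightarrow>
          \<bar>f s - f (e \<bullet> x0) - m * (s - e \<bullet> x0)\<bar> \<le> K * (s - e \<bullet> x0)\<^sup>2"
    using C2alpha_quadratic_bound[OF f \<open>0 < \<alpha>\<close>] by blast
  \<comment> \<open>An open set misses its frontier, so points of \<open>S\<close> near
    \<open>x0\<close> are strictly on one side of the graph; this upgrades the weak inequality of
    the second case below.\<close>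
  have off: "n \<bullet> p \<noteq> f (e \<bullet> p)" if "p \<in> S" "dist x0 p < r" for p
  proof
    assume "n \<bullet> p = f (e \<bullet> p)"
    then have "p \<in> frontier S" using graph that r rot by auto
    then show False using \<open>open S\<close> that(1) by (simp add: frontier_def interior_open)
  qed
  have close: "\<exists>p\<in>S. dist x0 p < \<epsilon>" if "\<epsilon> > 0" for \<epsilon>
    using x0(1) that by (auto simp: frontier_def closure_approachable dist_commute)
  show ?thesis
  proof (cases "\<forall>\<epsilon>>0. \<exists>p\<in>S. dist x0 p < \<epsilon> \<and> f (e \<bullet> p) < n \<bullet> p")
    case True
    show ?thesis
      by (rule interior_ball_above_graph[of e n x0 r S f K m])
         (use basis fr r fx0 K True that in auto)
  next
    case False
    then obtain \<epsilon>0 where \<epsilon>0: "\<epsilon>0 > 0" "\<And>p. p \<in> S \<Longrightarrow> dist x0 p < \<epsilon>0 \<Longrightarrow> n \<bullet> p \<le> f (e \<bullet> p)" by force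
    have near: "\<exists>p\<in>S. dist x0 p < \<epsilon> \<and> - f (e \<bullet> p) < - n \<bullet> p" if \<epsilon>: "\<epsilon> > 0" for \<epsilon>
    proof -
      obtain p where p: "p \<in> S" "dist x0 p < min \<epsilon> (min \<epsilon>0 r)"
        using close[of "min \<epsilon> (min \<epsilon>0 r)"] \<epsilon> \<epsilon>0(1) r(1) by (metis min_less_iff_conj)
      then have "n \<bullet> p < f (e \<bullet> p)" using \<epsilon>0(2)[of p] off[of p] by auto
      then show ?thesis using p by auto
    qed
    show ?thesis
    proof (rule interior_ball_above_graph[of e "- n" x0 r S "\<lambda>s. - f s" K "- m"])
      show "e \<bullet> e = 1" "- n \<bullet> - n = 1" "e \<bullet> - n = 0" using basis by simp_all
      show "x = (e \<bullet> x) *\<^sub>R e + (- n \<bullet> x) *\<^sub>R - n" for x using basis(4)[of x] by simp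
      show "- n \<bullet> x = - f (e \<bullet> x)" if "x \<in> ball x0 r" "x \<in> frontier S" for x using fr[OF that] by simp
      show "r > 0" "K > 0" by fact+
      show "- n \<bullet> x0 = - f (e \<bullet> x0)" using fx0 by simp
      show "\<bar>- f s - - f (e \<bullet> x0) - - m * (s - e \<bullet> x0)\<bar> \<le> K * (s - e \<bullet> x0)\<^sup>2"
        if "\<bar>s - e \<bullet> x0\<bar> \<le> 1" for s
        using K(2)[OF that] by linarith
      show "\<exists>p\<in>S. dist x0 p < \<epsilon> \<and> - f (e \<bullet> p) < - n \<bullet> p" if "\<epsilon> > 0" for \<epsilon> by (rule near[OF that])
    qed (use that r in auto)
  qed
qed

subsection \<open>Hopf's lemma\<close>

text \<open>At a maximum f' vanishes, so a positive derivative of f' makes f' positive just to the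
  right, and f increases there by the mean value theorem.\<close>

lemma second_derivative_pos_not_local_max:
  fixes f f' :: "real \<Rightarrow> real"
  assumes "\<delta> > 0" and f: "\<And>t. \<bar>t - a\<bar> < \<delta> \<Longrightarrow> (f has_real_derivative f' t) (at t)"
    and f': "(f' has_real_derivative c) (at a)" and "c > 0"
    and max: "\<And>t. \<bar>t - a\<bar> < \<delta> \<Longrightarrow> f t \<le> f a"
  shows False
proof -
  have "f' a = 0"
    using DERIV_local_max[OF f[of a] \<open>\<delta> > 0\<close>] max \<open>\<delta> > 0\<close> by (auto simp: abs_minus_commute)
  then obtain d where d: "d > 0" "\<And>h. 0 < h \<Longrightarrow> h < d \<Longrightarrow> f' (a + h) > 0"
    using DERIV_pos_inc_right[OF f' \<open>c > 0\<close>] by auto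
  define h where "h = min d \<delta> / 2"
  have h: "0 < h" "h < d" "h < \<delta>" using d(1) \<open>\<delta> > 0\<close> by (auto simp: h_def)
  then obtain t where t: "a < t" "t < a + h" "f (a + h) - f a = (a + h - a) * f' t"
    using MVT2[of a "a + h" f f'] f by force
  have "f' t > 0" using d(2)[of "t - a"] t h by simp
  then have "f (a + h) > f a" using t(3) h by (metis add_diff_cancel_left' diff_gt_0_iff_gt mult_pos_pos)
  then show False using max[of "a + h"] h by simp
qed

text \<open>The one-variable criterion is applied along the horizontal and the vertical line through
  \<open>z\<close>.\<close>

lemma laplacian_nonpos_at_max:
  assumes "open V" and v: "C1_partials V v v1 v2"
    and v1: "C1_partials V v1 v11 v12" and v2: "C1_partials V v2 v21 v22"
    and "z \<in> V" and max: "\<And>x. x \<in> V \<Longrightarrow> v x \<le> v z"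
  shows "v11 z + v22 z \<le> 0"
proof -
  obtain a b where z: "z = (a, b)" by fastforce
  obtain r where r: "r > 0" "ball z r \<subseteq> V" using \<open>open V\<close> \<open>z \<in> V\<close> open_contains_ball by blast
  have in1: "(s, b) \<in> V" if "\<bar>s - a\<bar> < r" for s
    using r that by (auto simp: z dist_Pair_Pair dist_real_def abs_minus_commute subset_iff)
  have in2: "(a, y) \<in> V" if "\<bar>y - b\<bar> < r" for y
    using r that by (auto simp: z dist_Pair_Pair dist_real_def abs_minus_commute subset_iff)
  have "\<not> v11 z > 0"
    using second_derivative_pos_not_local_max[of r a "\<lambda>s. v (s, b)" "\<lambda>s. v1 (s, b)" "v11 z"]
      C1_partials_fst_derivative[OF v in1] C1_partials_fst_derivative[OF v1 in1[of a]] max in1 r(1)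
    by (auto simp: z)
  moreover have "\<not> v22 z > 0"
    using second_derivative_pos_not_local_max[of r b "\<lambda>y. v (a, y)" "\<lambda>y. v2 (a, y)" "v22 z"]
      C1_partials_snd_derivative[OF v in2] C1_partials_snd_derivative[OF v2 in2[of b]] max in2 r(1)
    by (auto simp: z)
  ultimately show ?thesis by linarith
qed

section \<open>The barrier and comparison in an annulus\<close>

lemma C1_partials_inverse:
  assumes v: "C1_partials U v p q" and nz: "\<And>x. x \<in> U \<Longrightarrow> v x \<noteq> 0"
  shows "C1_partials U (\<lambda>x. inverse (v x)) (\<lambda>x. - p x * (inverse (v x))\<^sup>2) (\<lambda>x. - q x * (inverse (v x))\<^sup>2)"
proof -
  have "((\<lambda>x. inverse (v x)) has_derivative
     (\<lambda>h. - p x * (inverse (v x))\<^sup>2 * fst h + - q x * (inverse (v x))\<^sup>2 * snd h)) (at x)" if "x \<in> U" for x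
    by (rule has_derivative_eq_rhs[OF Deriv.has_derivative_inverse[OF nz[OF that] C1_partialsD(1)[OF v that]]])
       (auto simp: algebra_simps power2_eq_square)
  then show ?thesis
    unfolding C1_partials_def using C1_partialsD[OF v] nz by (auto intro!: continuous_intros)
qed

text \<open>In the plane the Laplacian of the s-th power of the distance to z is s^2 times its (s - 2)-th
  power, so every negative power is strictly subharmonic; s = -2 keeps all derivatives rational.\<close>

lemma barrier_partials:
  fixes z :: "real \<times> real"
  obtains w1 w2 w11 w12 w21 w22 where
    "C1_partials (- {z}) (\<lambda>x. 1 / (dist x z)\<^sup>2) w1 w2"
    "C1_partials (- {z}) w1 w11 w12" "C1_partials (- {z}) w2 w21 w22"
    "\<And>x. x \<noteq> z \<Longrightarrow> w11 x + w22 x > 0"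
proof -
  let ?U = "- {z}"
  define X Y where "X x = fst x - fst z" and "Y x = snd x - snd z" for x :: "real \<times> real"
  \<comment> \<open>The inverse squared distance in coordinates; its partials are -2 X J^2 and -2 Y
    J^2, polynomial in \<open>X\<close>, \<open>Y\<close>, \<open>J\<close>.\<close>
  define J where "J x = inverse (X x * X x + Y x * Y x)" for x
  have X: "C1_partials ?U X (\<lambda>x. 1) (\<lambda>x. 0)" and Y: "C1_partials ?U Y (\<lambda>x. 0) (\<lambda>x. 1)"
    unfolding C1_partials_def X_def Y_def by (auto intro!: derivative_eq_intros continuous_intros)
  have nz: "X x * X x + Y x * Y x \<noteq> 0" if "x \<in> ?U" for x
    using that by (auto simp: X_def Y_def sum_squares_eq_zero_iff prod_eq_iff)
  have J: "C1_partials ?U J (\<lambda>x. - (1 * X x + X x * 1 + (0 * Y x + Y x * 0)) * (J x)\<^sup>2)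
      (\<lambda>x. - (0 * X x + X x * 0 + (1 * Y x + Y x * 1)) * (J x)\<^sup>2)"
    unfolding J_def[abs_def]
    by (rule C1_partials_inverse[OF C1_partials_add[OF C1_partials_mult[OF X X] C1_partials_mult[OF Y Y]] nz])
  then have J: "C1_partials ?U J (\<lambda>x. - 2 * (X x * (J x * J x))) (\<lambda>x. - 2 * (Y x * (J x * J x)))"
    by (simp add: power2_eq_square algebra_simps)
  note w1 = C1_partials_cmult[OF C1_partials_mult[OF X C1_partials_mult[OF J J]], of "- 2"]
  note w2 = C1_partials_cmult[OF C1_partials_mult[OF Y C1_partials_mult[OF J J]], of "- 2"]
  have Jd: "J = (\<lambda>x. 1 / (dist x z)\<^sup>2)"
    by (simp add: fun_eq_iff J_def X_def Y_def dist_prod_def dist_real_def power2_eq_square inverse_eq_divide)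
  have w: "C1_partials ?U (\<lambda>x. 1 / (dist x z)\<^sup>2) (\<lambda>x. - 2 * (X x * (J x * J x))) (\<lambda>x. - 2 * (Y x * (J x * J x)))"
    using J unfolding Jd .
  show ?thesis
  proof (rule that[OF w w1 w2])
    fix x assume "x \<noteq> z"
    then have J1: "(X x * X x + Y x * Y x) * J x = 1" and J0: "J x \<noteq> 0" using nz[of x] by (auto simp: J_def)
    \<comment> \<open>The left side is -4 J^2 + 8 (X^2 + Y^2) J^3, which (X^2 + Y^2) J = 1 reduces
      to 4 J^2.\<close>
    have "- 2 * (1 * (J x * J x) + X x * (- 2 * (X x * (J x * J x)) * J x + J x * (- 2 * (X x * (J x * J x))))) +
      - 2 * (1 * (J x * J x) + Y x * (- 2 * (Y x * (J x * J x)) * J x + J x * (- 2 * (Y x * (J x * J x))))) =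
      4 * (J x * J x)"
      using J1 by algebra
    also have "\<dots> > 0" using J0 by (auto simp: zero_less_mult_iff linorder_neq_iff)
    finally show "0 < - 2 * (1 * (J x * J x) + X x * (- 2 * (X x * (J x * J x)) * J x + J x * (- 2 * (X x * (J x * J x))))) +
      - 2 * (1 * (J x * J x) + Y x * (- 2 * (Y x * (J x * J x)) * J x + J x * (- 2 * (Y x * (J x * J x)))))" .
  qed
qed

text \<open>Maximum principle for \<open>u\<close> plus \<kappa> times the barrier in the annulus
  between radii R / 2 and R. The resulting upper bound vanishes on the outer sphere with nonzero
  radial slope, which is the content of Hopf's lemma.\<close>

lemma hopf_barrier_bound:
  assumes u: "C1_partials V u u1 u2" "C1_partials V u1 u11 u12" "C1_partials V u2 u21 u22"
    and sub: "\<And>x. x \<in> V \<Longrightarrow> u11 x + u22 x \<ge> 0"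
    and "R > 0" and V: "ball z R \<subseteq> V" and cont: "continuous_on (cball z R) u"
    and neg: "\<And>x. x \<in> ball z R \<Longrightarrow> u x < 0"
  obtains \<kappa> where "\<kappa> > 0" "\<And>x. R / 2 \<le> dist x z \<Longrightarrow> dist x z \<le> R \<Longrightarrow> u x \<le> - \<kappa> * (1 / (dist x z)\<^sup>2 - 1 / R\<^sup>2)"
proof -
  have nonpos: "u x \<le> 0" if "x \<in> cball z R" for x
    using continuous_le_on_closure[of "ball z R" u x 0] cont that neg \<open>R > 0\<close>
    by (auto intro: less_imp_le)
  have sph: "sphere z (R / 2) \<noteq> {}" "sphere z (R / 2) \<subseteq> cball z R" using \<open>R > 0\<close> by auto
  then obtain y where y: "y \<in> sphere z (R / 2)" "\<And>x. x \<in> sphere z (R / 2) \<Longrightarrow> u x \<le> u y"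
    using continuous_attains_sup[of "sphere z (R / 2)" u] continuous_on_subset[OF cont]
    by (metis compact_sphere)
  have "u y < 0" using y(1) neg[of y] \<open>R > 0\<close> by auto
  \<comment> \<open>Solves u y + \<kappa> * 4 / R^2 = \<kappa> / R^2, so that the value \<kappa> /
    R^2 bounds \<open>v\<close> on the inner sphere, where \<open>u\<close> is at most
    \<open>u y\<close>, as it does on the outer one, where \<open>u\<close> is at most 0.\<close>
  define \<kappa> where "\<kappa> = - u y * R\<^sup>2 / 3"
  have \<kappa>: "\<kappa> > 0" using \<open>u y < 0\<close> \<open>R > 0\<close> by (simp add: \<kappa>_def divide_neg_pos mult_neg_pos)
  define A where "A = cball z R - ball z (R / 2)"
  define v where "v x = u x + \<kappa> * (1 / (dist x z)\<^sup>2)" for x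
  have zA: "dist x z > 0" if "x \<in> A" for x using that \<open>R > 0\<close> by (auto simp: A_def dist_commute)
  have "compact A" unfolding A_def by (intro compact_diff) auto
  moreover have "y \<in> A" using y(1) \<open>R > 0\<close> by (simp add: A_def)
  then have "A \<noteq> {}" by blast
  moreover have "continuous_on A v"
  proof -
    have "continuous_on A u" by (rule continuous_on_subset[OF cont]) (simp add: A_def)
    moreover have "(dist x z)\<^sup>2 \<noteq> 0" if "x \<in> A" for x using zA[OF that] by simp
    ultimately show ?thesis unfolding v_def by (intro continuous_intros ballI) auto
  qed
  ultimately have "\<exists>p\<in>A. \<forall>x\<in>A. v x \<le> v p" by (rule continuous_attains_sup)
  then obtain p where p: "p \<in> A" "\<And>x. x \<in> A \<Longrightarrow> v x \<le> v p" by blast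
  \<comment> \<open>A maximum on either sphere is settled by the choice of \<kappa>; one in the open
    annulus contradicts the strictly positive Laplacian of \<open>v\<close>.\<close>
  have vp: "v p \<le> \<kappa> / R\<^sup>2"
  proof (rule ccontr)
    assume big: "\<not> v p \<le> \<kappa> / R\<^sup>2"
    have "dist p z \<noteq> R" using big nonpos[of p] p(1) by (auto simp: v_def A_def)
    moreover have "dist p z \<noteq> R / 2"
    proof
      assume d: "dist p z = R / 2"
      then have "u p \<le> u y" using y(2) by (simp add: dist_commute)
      then have "v p \<le> u y + \<kappa> * (1 / (R / 2)\<^sup>2)" by (simp add: v_def d)
      also have "\<dots> = \<kappa> / R\<^sup>2" using \<open>R > 0\<close> by (simp add: \<kappa>_def field_simps power2_eq_square)
      finally show False using big by simp
    qed
    ultimately have pW: "p \<in> ball z R - cball z (R / 2)" (is "p \<in> ?W")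
      using p(1) by (auto simp: A_def dist_commute)
    have WV: "?W \<subseteq> V" using V by auto
    have Wz: "?W \<subseteq> - {z}" using \<open>R > 0\<close> by auto
    obtain w1 w2 w11 w12 w21 w22 where w: "C1_partials (- {z}) (\<lambda>x. 1 / (dist x z)\<^sup>2) w1 w2"
      "C1_partials (- {z}) w1 w11 w12" "C1_partials (- {z}) w2 w21 w22" "\<And>x. x \<noteq> z \<Longrightarrow> w11 x + w22 x > 0"
      using barrier_partials[of z] by blast
    note uW = u[THEN C1_partials_subset, OF WV]
    note wW = w(1-3)[THEN C1_partials_subset, OF Wz, THEN C1_partials_cmult, of \<kappa>]
    have "(u11 p + \<kappa> * w11 p) + (u22 p + \<kappa> * w22 p) \<le> 0"
    proof (rule laplacian_nonpos_at_max[OF _ C1_partials_add[OF uW(1) wW(1)] C1_partials_add[OF uW(2) wW(2)]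
          C1_partials_add[OF uW(3) wW(3)] pW])
      show "u x + \<kappa> * (1 / (dist x z)\<^sup>2) \<le> u p + \<kappa> * (1 / (dist p z)\<^sup>2)" if "x \<in> ?W" for x
        using p(2)[of x] that by (auto simp: v_def A_def)
    qed auto
    moreover have "u11 p + u22 p \<ge> 0" using sub WV pW by blast
    moreover have "\<kappa> * (w11 p + w22 p) > 0"
      using \<kappa> w(4)[of p] subsetD[OF Wz pW] by simp
    ultimately show False by (simp add: algebra_simps)
  qed
  have "u x \<le> - \<kappa> * (1 / (dist x z)\<^sup>2 - 1 / R\<^sup>2)" if "R / 2 \<le> dist x z" "dist x z \<le> R" for x
  proof -
    have "x \<in> A" using that by (simp add: A_def dist_commute)
    then have "v x \<le> \<kappa> / R\<^sup>2" using p(2) vp by (meson order_trans)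
    then show ?thesis by (simp add: v_def algebra_simps)
  qed
  then show ?thesis using that \<kappa> by blast
qed

section \<open>Contradiction at a stagnation point\<close>

theorem theorem3p17:
  fixes \<Omega> :: "(real \<times> real) set" and x20 :: real and u :: "real \<times> real \<Rightarrow> real"
  assumes "open \<Omega>"
    and "weak_solution \<Omega> x20 u"
  shows "\<not> (\<exists>x\<in>stagnation_set \<Omega> u. snd x > x20)"
proof
  assume "\<exists>x\<in>stagnation_set \<Omega> u. snd x > x20"
  then obtain x where x: "x \<in> stagnation_set \<Omega> u" and x2: "x20 < snd x" by blast
  define S where "S = {y \<in> \<Omega>. u y < 0}"
  have xfr: "x \<in> frontier S" and x\<Omega>: "x \<in> \<Omega>"
    and der: "(uminus_part u has_derivative (\<lambda>h. 0)) (at x within S)"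
    using x by (auto simp: stagnation_set_def S_def)
  obtain \<alpha> where contu: "continuous_on \<Omega> u" and \<alpha>: "0 < \<alpha>" "locally_C2alpha_curve \<alpha> (frontier S) \<Omega>"
    using assms(2) unfolding weak_solution_def S_def by blast
  have "open (\<Omega> \<inter> u -` {..<0})" using contu \<open>open \<Omega>\<close> by (intro continuous_open_preimage) auto
  moreover have "\<Omega> \<inter> u -` {..<0} = S" by (auto simp: S_def)
  ultimately have S: "open S" by simp
  have "open (\<Omega> \<inter> {x. x20 < snd x})"
    using \<open>open \<Omega>\<close> by (intro open_Int open_Collect_less continuous_intros)
  then obtain \<delta> where \<delta>: "\<delta> > 0" "ball x \<delta> \<subseteq> \<Omega> \<inter> {x. x20 < snd x}"
    using x\<Omega> x2 open_contains_ball by (metis IntI mem_Collect_eq)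
  \<comment> \<open>Points of the closed touching ball are within 2 * R of \<open>x\<close>, so R <
    \<delta> / 2 keeps that ball in \<Omega> and above height \<open>x20\<close>.\<close>
  have "\<delta> / 2 > 0" using \<delta>(1) by simp
  then obtain z R where R: "0 < R" "R < \<delta> / 2" and zR: "ball z R \<subseteq> S" "dist z x = R"
    by (rule interior_ball_C2alpha_curve[OF S xfr x\<Omega> \<alpha>(2,1)])
  have cball: "cball z R \<subseteq> \<Omega> \<inter> {x. x20 < snd x}"
  proof
    fix y assume "y \<in> cball z R"
    then have "dist x y < \<delta>" using dist_triangle[of x y z] zR(2) R by (simp add: dist_commute)
    then show "y \<in> \<Omega> \<inter> {x. x20 < snd x}" using \<delta>(2) by auto
  qed
  obtain u1 u2 u11 u12 u21 u22 where P: "C1_partials {x \<in> \<Omega>. u x < 0 \<and> x20 < snd x} u u1 u2"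
    "C1_partials {x \<in> \<Omega>. u x < 0 \<and> x20 < snd x} u1 u11 u12"
    "C1_partials {x \<in> \<Omega>. u x < 0 \<and> x20 < snd x} u2 u21 u22"
    and harm: "\<And>x. x \<in> \<Omega> \<Longrightarrow> u x < 0 \<Longrightarrow> x20 < snd x \<Longrightarrow> u11 x + u22 x = 0"
    using weak_solution_harmonic[OF assms] by blast
  obtain \<kappa> where \<kappa>: "\<kappa> > 0"
    "\<And>y. R / 2 \<le> dist y z \<Longrightarrow> dist y z \<le> R \<Longrightarrow> u y \<le> - \<kappa> * (1 / (dist y z)\<^sup>2 - 1 / R\<^sup>2)"
  proof (rule hopf_barrier_bound[OF P _ R(1)])
    show "ball z R \<subseteq> {x \<in> \<Omega>. u x < 0 \<and> x20 < snd x}"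
      using zR(1) cball ball_subset_cball[of z R] unfolding S_def by blast
    show "continuous_on (cball z R) u" using contu cball by (auto intro: continuous_on_subset)
    show "u y < 0" if "y \<in> ball z R" for y using that zR(1) by (auto simp: S_def)
  qed (auto simp: harm)
  have "x \<notin> S" using xfr S by (simp add: frontier_def interior_open)
  then have ux: "uminus_part u x = 0" using x\<Omega> by (simp add: uminus_part_def S_def)
  \<comment> \<open>The barrier has radial slope 2 * \<kappa> / R^3 at the sphere; half of it is a
    tolerance that a zero derivative must eventually respect but \<open>u\<close> cannot.\<close>
  have "\<kappa> / R ^ 3 > 0" using \<kappa>(1) R(1) by simp
  then obtain d where d: "d > 0"
    "\<And>y. y \<in> S \<Longrightarrow> norm (y - x) < d \<Longrightarrow> norm (uminus_part u y - uminus_part u x - 0) \<le> \<kappa> / R ^ 3 * norm (y - x)"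
    using der unfolding has_derivative_within_alt by meson
  \<comment> \<open>With t <= 1 / 2 the point \<open>y\<close> stays in the annulus of the barrier
    bound; t * R < d puts it in the range of the derivative estimate.\<close>
  define t where "t = min (1 / 2) (d / (2 * R))"
  have t: "0 < t" "t \<le> 1 / 2" "t * R < d"
  proof -
    show "0 < t" "t \<le> 1 / 2" using d(1) R(1) by (auto simp: t_def)
    have "t * R \<le> d / (2 * R) * R" using R(1) by (intro mult_right_mono) (auto simp: t_def)
    then show "t * R < d" using R(1) d(1) by simp
  qed
  define y where "y = x + t *\<^sub>R (z - x)"
  have yx: "norm (y - x) = t * R" using t(1) zR(2) by (simp add: y_def dist_norm)
  have "y - z = (1 - t) *\<^sub>R (x - z)" by (simp add: y_def algebra_simps)
  then have yz: "dist y z = (1 - t) * R" using t zR(2) by (simp add: dist_norm norm_minus_commute)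
  have "R / 2 \<le> (1 - t) * R" "(1 - t) * R < R"
    using t R(1) mult_right_mono[of "1/2" "1 - t" R] by (auto simp: algebra_simps)
  then have "y \<in> S" and uy: "u y \<le> - \<kappa> * (1 / ((1 - t) * R)\<^sup>2 - 1 / R\<^sup>2)"
    using zR(1) \<kappa>(2)[of y] t(1) by (auto simp: yz dist_commute)
  have "u y < 0" using \<open>y \<in> S\<close> by (simp add: S_def)
  then have "- u y \<le> \<kappa> / R ^ 3 * (t * R)"
    using d(2)[OF \<open>y \<in> S\<close>] t(3) ux by (simp add: yx uminus_part_def)
  also have "\<dots> = \<kappa> / R\<^sup>2 * t" using R(1) by (simp add: field_simps power2_eq_square power3_eq_cube)
  finally have upper: "- u y \<le> \<kappa> / R\<^sup>2 * t" .
  \<comment> \<open>Along the radius the barrier bound is \<kappa> / R^2 times 1 / (1 - t)^2 - 1,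
    the derivative estimate \<kappa> / R^2 times t. Strictness is essential, as the two bounds on
    \<open>- u y\<close> are both weak.\<close>
  have "1 + t < 1 / (1 - t)\<^sup>2"
  proof -
    have "t\<^sup>2 \<le> t" using t by (simp add: power2_eq_square mult_left_le)
    then have "0 < t * (1 + t - t\<^sup>2)" using t(1) by (intro mult_pos_pos) auto
    moreover have "(1 + t) * (1 - t)\<^sup>2 = 1 - t * (1 + t - t\<^sup>2)" by (simp add: power2_eq_square algebra_simps)
    ultimately have "(1 + t) * (1 - t)\<^sup>2 < 1" by simp
    moreover have "0 < (1 - t)\<^sup>2" using t by simp
    ultimately show ?thesis by (simp add: pos_less_divide_eq)
  qed
  then have "\<kappa> / R\<^sup>2 * t < \<kappa> / R\<^sup>2 * (1 / (1 - t)\<^sup>2 - 1)"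
    using \<kappa>(1) R(1) by (intro mult_strict_left_mono) auto
  also have "\<dots> = \<kappa> * (1 / ((1 - t) * R)\<^sup>2 - 1 / R\<^sup>2)"
    by (simp add: power_mult_distrib right_diff_distrib)
  finally show False using upper uy by simp
qed

end
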